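(* Let $d\ge 3$ and let $(\varphi_\alpha)_{\alpha\in\mathbb Z^d}$ be the infinite-volume discrete Gaussian free field on $\mathbb Z^d$ with law $\mathsf P$, i.e. the centered Gaussian field with covariance $\mathsf E[\varphi_\alpha\varphi_\beta]=g(\alpha-\beta)$, where $g$ is the Green's function of simple random walk. Define $$b_N=\sqrt{g(0)}\left[\sqrt{2\log N}-\frac{\log\log N+\log(4\pi)}{2\sqrt{2\log N}}\right],\qquad a_N=g(0)\,b_N^{-1}.$$ For each $N$ let $A=A_N$ be a finite subset of $\mathbb Z^d$ with $|A_N|=N$. Then for all $z\in\mathbb R$, $$\lim_{N\to+\infty}\mathsf P\left(\frac{\max_{\alpha\in A_N}\varphi_\alpha-b_N}{a_N}<z\right)=\exp(-e^{-z}).$$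
   Context: For $\alpha,\beta\in\mathbb Z^d$, $g(\alpha,\beta)=\mathbb E_\alpha\big[\sum_{n\ge0}\mathbf 1_{\{S_n=\beta\}}\big]$, where $(S_n)$ is a simple random walk on $\mathbb Z^d$ started at $\alpha$ under $\mathbb P_\alpha$; one writes $g(\alpha-\beta)=g(0,\alpha-\beta)=g(\alpha,\beta)$. Since $d\ge3$, $g(0)<\infty$. The infinite-volume DGFF is the weak limit as $\Lambda\uparrow\mathbb Z^d$ of the DGFF with zero boundary conditions outside $\Lambda$, and is the centered Gaussian field with covariance $g$. *)

theory Defs
  imports "HOL-Probability.Probability"
begin

fun srw_p :: "nat \<Rightarrow> (int ^ 'd::finite) \<Rightarrow> real" where
  "srw_p 0 x = (if x = 0 then 1 else 0)"
| "srw_p (Suc n) x =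
     (\<Sum>i\<in>(UNIV::'d set). srw_p n (x - axis i 1) + srw_p n (x + axis i 1))
       / (2 * real CARD('d))"

definition green :: "(int ^ 'd::finite) \<Rightarrow> real" where
  "green x = (\<Sum>n. srw_p n x)"

text \<open>A centered Gaussian field on a probability space M with covariance C:
  every finite linear combination has characteristic function exp(-Var/2).\<close>
definition centered_gaussian_field ::
  "'a measure \<Rightarrow> ('i \<Rightarrow> 'a \<Rightarrow> real) \<Rightarrow> ('i \<Rightarrow> 'i \<Rightarrow> real) \<Rightarrow> bool" where
  "centered_gaussian_field M \<phi> C \<longleftrightarrow>
     prob_space M \<and> (\<forall>a. \<phi> a \<in> borel_measurable M) \<and>
     (\<forall>F c. finite F \<longrightarrow>
        (LINT \<omega>|M. cis (\<Sum>a\<in>F. c a * \<phi> a \<omega>)) =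
          complex_of_real (exp (- (\<Sum>a\<in>F. \<Sum>b\<in>F. c a * c b * C a b) / 2)))"

definition dgff_b :: "real \<Rightarrow> nat \<Rightarrow> real" where
  "dgff_b g0 N = sqrt g0 * (sqrt (2 * ln (real N))
      - (ln (ln (real N)) + ln (4 * pi)) / (2 * sqrt (2 * ln (real N))))"

definition dgff_a :: "real \<Rightarrow> nat \<Rightarrow> real" where
  "dgff_a g0 N = g0 / dgff_b g0 N"

end

theory Submission
  imports Defs "HOL-Computational_Algebra.Formal_Power_Series" "HOL-Real_Asymp.Real_Asymp"
begin

text \<open>Order \<open>A\<close> arbitrarily and add the points one at a time. With \<open>p\<close> the common exceedance
  probability of the level \<open>u\<close>, each new point multiplies the probability of no exceedance by
  \<open>1 - p\<close> up to an error, so it suffices that the errors are \<open>o(1/N)\<close>; the limit is then that of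
  \<open>(1 - p)^N\<close> with \<open>N p \<rightarrow> exp (- z)\<close>. To bound the error at a point \<open>a\<close>, split the earlier points
  by whether their covariance with \<open>a\<close> exceeds \<open>g(0) / (ln N)^2\<close>. There are only polylogarithmically
  many near points, because \<open>p\<^sub>n(x) = O(n^(-3/2))\<close>, and joint exceedances with them are negligible
  because \<open>g(x)\<close> is bounded away from \<open>g(0)\<close> for \<open>x \<noteq> 0\<close>. The conditional mean of \<open>\<phi> a\<close> given
  the far points is the average of the field over the hitting distribution of the walk from \<open>a\<close>, so
  its variance is at most \<open>g(0) / (ln N)^2\<close>, which is too small to shift a level of order
  \<open>sqrt (ln N)\<close>.\<close>

section \<open>Uniqueness of joint characteristic functions\<close>

text \<open>The field is known only through characteristic functions of finite linear combinations.
  Conditioning on the far points is therefore realised on a second probability space, the original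
  one times an independent standard normal: its joint characteristic functions agree with those of
  the field, and uniqueness transfers the probabilities.

  The scale \<open>s = g(0) / (ln N)^2\<close> is a compromise. It admits \<open>O(s^(-3))\<close>
  near points, that is \<open>(ln N)^6\<close>, against which a joint exceedance gains a power of
  \<open>N\<close>. The conditional mean then has standard deviation of order
  \<open>1 / ln N\<close>, whereas a shift of the level matters only from order
  \<open>1 / b_N\<close>, that is \<open>1 / sqrt (ln N)\<close>, on. A shift by
  \<open>e / b_N\<close> in units of \<open>sqrt (g(0))\<close> changes the limit of
  \<open>N p\<close> from \<open>exp (- z)\<close> to \<open>exp (- (z + e))\<close>, so
  \<open>e\<close> has to tend to 0 after \<open>N\<close>.

  The shape of \<open>A\<close> never enters: near points are counted through level sets of the
  Green's function in the whole lattice.\<close>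

lemma weighted_char_unique:
  fixes X :: "'a \<Rightarrow> real" and Y :: "'b \<Rightarrow> real" and f :: "'a \<Rightarrow> real" and g :: "'b \<Rightarrow> real"
  assumes P: "prob_space P" and Q: "prob_space Q"
    and [measurable]: "X \<in> borel_measurable P" "Y \<in> borel_measurable Q"
      "f \<in> borel_measurable P" "g \<in> borel_measurable Q" "B \<in> sets borel"
    and f: "\<And>w. 0 \<le> f w" "\<And>w. f w \<le> c" and g: "\<And>w. 0 \<le> g w" "\<And>w. g w \<le> c"
    and char_eq: "\<And>t. (LINT w|P. f w *\<^sub>R cis (t * X w)) = (LINT w|Q. g w *\<^sub>R cis (t * Y w))"
  shows "(LINT w|P. f w * indicator B (X w)) = (LINT w|Q. g w * indicator B (Y w))"
proof -
  interpret P: prob_space P by fact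
  interpret Q: prob_space Q by fact
  have intf: "integrable P f" by (rule P.integrable_const_bound[of _ c]) (use f in auto)
  have intg: "integrable Q g" by (rule Q.integrable_const_bound[of _ c]) (use g in auto)
  define m where "m = (LINT w|P. f w)"
  have "complex_of_real (LINT w|P. f w) = complex_of_real (LINT w|Q. g w)"
    using char_eq[of 0] by (simp add: scaleR_conv_of_real)
  then have mQ: "(LINT w|Q. g w) = m" by (simp add: m_def)
  have "0 \<le> m" unfolding m_def by (rule integral_nonneg_AE) (use f in auto)
  show ?thesis
  proof (cases "m = 0")
    case True
    then have "AE w in P. f w = 0" "AE w in Q. g w = 0"
      using integral_nonneg_eq_0_iff_AE[OF intf] integral_nonneg_eq_0_iff_AE[OF intg] f g m_def mQ
      by auto
    then have "(LINT w|P. f w * indicator B (X w)) = 0" "(LINT w|Q. g w * indicator B (Y w)) = 0"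
      by (auto intro!: integral_eq_zero_AE)
    then show ?thesis by simp
  next
    case False
    with \<open>0 \<le> m\<close> have m: "m > 0" by simp
    \<comment> \<open>A weight divided by its total mass \<open>m\<close> is a probability density,
      which reduces the claim to one-dimensional uniqueness. The mass is the weighted characteristic
      function at 0, so it agrees on both sides; mass 0 is treated separately.\<close>
    have distr_char: "real_distribution (distr (density R (\<lambda>w. h w / m)) borel Z) \<and>
       char (distr (density R (\<lambda>w. h w / m)) borel Z) t = (LINT w|R. h w *\<^sub>R cis (t * Z w)) / m \<and>
       measure (distr (density R (\<lambda>w. h w / m)) borel Z) B = (LINT w|R. h w * indicator B (Z w)) / m"
      if [measurable]: "h \<in> borel_measurable R" "Z \<in> borel_measurable R"
        and h: "\<And>w. 0 \<le> h w" and int: "integrable R h" "(LINT w|R. h w) = m"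
      for R :: "'c measure" and h Z t
    proof (intro conjI)
      have "(\<integral>\<^sup>+w. ennreal (h w / m) \<partial>R) = ennreal (LINT w|R. h w / m)"
        by (rule nn_integral_eq_integral) (use int h m in auto)
      also have "\<dots> = 1" using int m by simp
      finally have "prob_space (density R (\<lambda>w. h w / m))"
        by (intro prob_spaceI) (auto simp: emeasure_density intro!: nn_integral_cong)
      then have "prob_space (distr (density R (\<lambda>w. h w / m)) borel Z)"
        by (rule prob_space.prob_space_distr) simp
      then show rd: "real_distribution (distr (density R (\<lambda>w. h w / m)) borel Z)"
        by (simp add: real_distribution_def real_distribution_axioms_def)
      show "char (distr (density R (\<lambda>w. h w / m)) borel Z) t = (LINT w|R. h w *\<^sub>R cis (t * Z w)) / m"
        unfolding char_def
        by (subst integral_distr, simp, simp, subst integral_density)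
           (use h m in \<open>auto simp: cis_conv_exp scaleR_conv_of_real\<close>)
      interpret D: real_distribution "distr (density R (\<lambda>w. h w / m)) borel Z" by (rule rd)
      have "measure (distr (density R (\<lambda>w. h w / m)) borel Z) B
          = (LINT x|distr (density R (\<lambda>w. h w / m)) borel Z. indicator B x)"
        by simp
      also have "\<dots> = (LINT w|R. h w * indicator B (Z w)) / m"
        by (subst integral_distr, simp, simp, subst integral_density) (use h m in auto)
      finally show "measure (distr (density R (\<lambda>w. h w / m)) borel Z) B = (LINT w|R. h w * indicator B (Z w)) / m" .
    qed
    note 1 = distr_char[of f P X, OF _ _ f(1) intf m_def[symmetric], simplified]
    note 2 = distr_char[of g Q Y, OF _ _ g(1) intg mQ, simplified]
    have "distr (density P (\<lambda>w. f w / m)) borel X = distr (density Q (\<lambda>w. g w / m)) borel Y"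
      by (rule Levy_uniqueness) (use 1 2 char_eq in auto)
    then show ?thesis using 1 2 m by auto
  qed
qed

text \<open>Tilting by the positive weights \<open>1 + cos S\<close> and \<open>1 + sin S\<close> reduces the joint
  statement to the one-dimensional uniqueness theorem.\<close>

lemma tilted_char_unique:
  fixes X S :: "'a \<Rightarrow> real" and Y T :: "'b \<Rightarrow> real" and f :: "'a \<Rightarrow> real" and g :: "'b \<Rightarrow> real"
  assumes P: "prob_space P" and Q: "prob_space Q"
    and [measurable]: "X \<in> borel_measurable P" "Y \<in> borel_measurable Q"
      "S \<in> borel_measurable P" "T \<in> borel_measurable Q"
      "f \<in> borel_measurable P" "g \<in> borel_measurable Q" "B \<in> sets borel"
    and f: "\<And>w. 0 \<le> f w" "\<And>w. f w \<le> 1" and g: "\<And>w. 0 \<le> g w" "\<And>w. g w \<le> 1"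
    and char_eq: "\<And>t s. (LINT w|P. f w *\<^sub>R cis (t * X w + s * S w)) = (LINT w|Q. g w *\<^sub>R cis (t * Y w + s * T w))"
  shows "(LINT w|P. (f w * indicator B (X w)) *\<^sub>R cis (S w)) = (LINT w|Q. (g w * indicator B (Y w)) *\<^sub>R cis (T w))"
proof -
  interpret P: prob_space P by fact
  interpret Q: prob_space Q by fact
  have bndP: "integrable P (\<lambda>w. f w *\<^sub>R h w)" if [measurable]: "h \<in> borel_measurable P" and "\<And>w. norm (h w) \<le> 1" for h :: "'a \<Rightarrow> complex"
    by (rule P.integrable_const_bound[of _ 1]) (use f that in \<open>auto simp: mult_le_one\<close>)
  have bndQ: "integrable Q (\<lambda>w. g w *\<^sub>R h w)" if [measurable]: "h \<in> borel_measurable Q" and "\<And>w. norm (h w) \<le> 1" for h :: "'b \<Rightarrow> complex"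
    by (rule Q.integrable_const_bound[of _ 1]) (use g that in \<open>auto simp: mult_le_one\<close>)
  have rbndP: "integrable P (\<lambda>w. f w * indicator B (X w) * h w)" if [measurable]: "h \<in> borel_measurable P" and "\<And>w. norm (h w) \<le> 1" for h :: "'a \<Rightarrow> real"
    by (rule P.integrable_const_bound[of _ 1]) (use f that in \<open>auto simp: mult_le_one abs_mult indicator_def\<close>)
  have rbndQ: "integrable Q (\<lambda>w. g w * indicator B (Y w) * h w)" if [measurable]: "h \<in> borel_measurable Q" and "\<And>w. norm (h w) \<le> 1" for h :: "'b \<Rightarrow> real"
    by (rule Q.integrable_const_bound[of _ 1]) (use g that in \<open>auto simp: mult_le_one abs_mult indicator_def\<close>)
  have cisM [measurable]: "cis \<in> borel_measurable borel"
    by (intro borel_measurable_continuous_onI continuous_intros)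
  have base: "(LINT w|P. f w * indicator B (X w)) = (LINT w|Q. g w * indicator B (Y w))"
    by (rule weighted_char_unique[OF P Q, where c = 1]) (use f g char_eq[of _ 0] in auto)
  \<comment> \<open>\<open>u = 1\<close> gives the cosine and \<open>u = - \<i>\<close> the sine; at
    the end they provide the real and the imaginary part.\<close>
  have tilt: "(LINT w|P. (f w * (1 + Re (u * cis (S w)))) * indicator B (X w))
      = (LINT w|Q. (g w * (1 + Re (u * cis (T w)))) * indicator B (Y w))" if u: "norm u = 1" for u
  proof (rule weighted_char_unique[OF P Q, where c = 2])
    have re: "\<bar>Re (u * cis s)\<bar> \<le> 1" for s
      using abs_Re_le_cmod[of "u * cis s"] u by (simp add: norm_mult)
    have re': "0 \<le> 1 + Re (u * cis s)" "1 + Re (u * cis s) \<le> 2" for s using re[of s] by auto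
    show "0 \<le> f w * (1 + Re (u * cis (S w)))" for w using f re'(1)[of "S w"] by (intro mult_nonneg_nonneg) auto
    show "0 \<le> g w * (1 + Re (u * cis (T w)))" for w using g re'(1)[of "T w"] by (intro mult_nonneg_nonneg) auto
    show "f w * (1 + Re (u * cis (S w))) \<le> 2" for w
      using mult_mono[OF f(2)[of w] re'(2)[of "S w"]] f re'(1)[of "S w"] by simp
    show "g w * (1 + Re (u * cis (T w))) \<le> 2" for w
      using mult_mono[OF g(2)[of w] re'(2)[of "T w"]] g re'(1)[of "T w"] by simp
    \<comment> \<open>Writing \<open>Re\<close> through the conjugate leaves only the phases
      \<open>x\<close>, \<open>x + s\<close> and \<open>x - s\<close>, so \<open>char_eq\<close> is
      needed at second argument 0, 1 and -1.\<close>
    have split: "(h * (1 + Re (u * cis s))) *\<^sub>R cis x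
        = h *\<^sub>R cis x + (u / 2) * (h *\<^sub>R cis (x + s)) + (cnj u / 2) * (h *\<^sub>R cis (x - s))" for h s x
    proof -
      have "complex_of_real (Re (u * cis s)) = (u * cis s + cnj u * cis (- s)) / 2"
        by (simp add: complex_eq_iff)
      moreover have "cis (x + s) = cis x * cis s" "cis (x - s) = cis x * cis (- s)"
        by (simp_all add: cis_mult)
      ultimately show ?thesis by (simp add: scaleR_conv_of_real field_simps)
    qed
    show "(LINT w|P. (f w * (1 + Re (u * cis (S w)))) *\<^sub>R cis (t * X w))
       = (LINT w|Q. (g w * (1 + Re (u * cis (T w)))) *\<^sub>R cis (t * Y w))" for t
    proof -
      have "(LINT w|P. (f w * (1 + Re (u * cis (S w)))) *\<^sub>R cis (t * X w))
        = (LINT w|P. f w *\<^sub>R cis (t * X w)) + (u / 2) * (LINT w|P. f w *\<^sub>R cis (t * X w + S w))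
           + (cnj u / 2) * (LINT w|P. f w *\<^sub>R cis (t * X w - S w))"
        unfolding split using bndP[of "\<lambda>w. cis (t * X w)"] bndP[of "\<lambda>w. cis (t * X w + S w)"]
          bndP[of "\<lambda>w. cis (t * X w - S w)"]
        by (simp add: Bochner_Integration.integral_add integrable_mult_right del: mult_scaleR_right times_divide_eq_left)
      moreover have "(LINT w|Q. (g w * (1 + Re (u * cis (T w)))) *\<^sub>R cis (t * Y w))
        = (LINT w|Q. g w *\<^sub>R cis (t * Y w)) + (u / 2) * (LINT w|Q. g w *\<^sub>R cis (t * Y w + T w))
           + (cnj u / 2) * (LINT w|Q. g w *\<^sub>R cis (t * Y w - T w))"
        unfolding split using bndQ[of "\<lambda>w. cis (t * Y w)"] bndQ[of "\<lambda>w. cis (t * Y w + T w)"]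
          bndQ[of "\<lambda>w. cis (t * Y w - T w)"]
        by (simp add: Bochner_Integration.integral_add integrable_mult_right del: mult_scaleR_right times_divide_eq_left)
      ultimately show ?thesis using char_eq[of t 0] char_eq[of t 1] char_eq[of t "-1"] by simp
    qed
  qed measurable
  have part: "(LINT w|P. f w * indicator B (X w) * Re (u * cis (S w)))
      = (LINT w|Q. g w * indicator B (Y w) * Re (u * cis (T w)))" if u: "norm u = 1" for u
  proof -
    have re: "\<bar>Re (u * cis s)\<bar> \<le> 1" for s
      using abs_Re_le_cmod[of "u * cis s"] u by (simp add: norm_mult)
    have "(LINT w|P. (f w * (1 + Re (u * cis (S w)))) * indicator B (X w))
      = (LINT w|P. f w * indicator B (X w)) + (LINT w|P. f w * indicator B (X w) * Re (u * cis (S w)))"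
      using rbndP[of "\<lambda>_. 1"] rbndP[of "\<lambda>w. Re (u * cis (S w))"] re
      by (subst Bochner_Integration.integral_add[symmetric]) (auto simp: algebra_simps)
    moreover have "(LINT w|Q. (g w * (1 + Re (u * cis (T w)))) * indicator B (Y w))
      = (LINT w|Q. g w * indicator B (Y w)) + (LINT w|Q. g w * indicator B (Y w) * Re (u * cis (T w)))"
      using rbndQ[of "\<lambda>_. 1"] rbndQ[of "\<lambda>w. Re (u * cis (T w))"] re
      by (subst Bochner_Integration.integral_add[symmetric]) (auto simp: algebra_simps)
    ultimately show ?thesis using base tilt[OF u] by simp
  qed
  have ci: "integrable P (\<lambda>w. (f w * indicator B (X w)) *\<^sub>R cis (S w))"
    using bndP[of "\<lambda>w. indicator B (X w) *\<^sub>R cis (S w)"] by (simp add: indicator_def)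
  have ci': "integrable Q (\<lambda>w. (g w * indicator B (Y w)) *\<^sub>R cis (T w))"
    using bndQ[of "\<lambda>w. indicator B (Y w) *\<^sub>R cis (T w)"] by (simp add: indicator_def)
  show ?thesis
    using part[of 1] part[of "- \<i>"] integral_Re[OF ci] integral_Re[OF ci'] integral_Im[OF ci] integral_Im[OF ci']
    by (simp add: complex_eq_iff)
qed

text \<open>Phases are turned into indicators one coordinate at a time: \<open>D\<close> holds the
  coordinates already converted, and \<open>tilted_char_unique\<close> converts one more while the
  remaining phases form \<open>S\<close> and \<open>T\<close>. At \<open>D = F\<close> only the
  event is left.\<close>

lemma joint_char_unique:
  fixes X :: "'i \<Rightarrow> 'a \<Rightarrow> real" and Y :: "'i \<Rightarrow> 'b \<Rightarrow> real"
  assumes P: "prob_space P" and Q: "prob_space Q" and F: "finite F"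
    and X [measurable]: "\<And>i. X i \<in> borel_measurable P" and Y [measurable]: "\<And>i. Y i \<in> borel_measurable Q"
    and B [measurable]: "\<And>i. B i \<in> sets borel"
    and char_eq: "\<And>c. (LINT w|P. cis (\<Sum>i\<in>F. c i * X i w)) = (LINT w|Q. cis (\<Sum>i\<in>F. c i * Y i w))"
  shows "measure P {w\<in>space P. \<forall>i\<in>F. X i w \<in> B i} = measure Q {w\<in>space Q. \<forall>i\<in>F. Y i w \<in> B i}"
proof -
  interpret P: prob_space P by fact
  interpret Q: prob_space Q by fact
  have "(LINT w|P. (\<Prod>i\<in>D. indicator (B i) (X i w)) *\<^sub>R cis (\<Sum>i\<in>F-D. c i * X i w))
      = (LINT w|Q. (\<Prod>i\<in>D. indicator (B i) (Y i w)) *\<^sub>R cis (\<Sum>i\<in>F-D. c i * Y i w))"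
    if "D \<subseteq> F" for D c
    using finite_subset[OF that F] that
  proof (induction D arbitrary: c)
    case empty
    then show ?case using char_eq by simp
  next
    case (insert j D)
    define S where "S w = (\<Sum>i\<in>F - insert j D. c i * X i w)" for w
    define T where "T w = (\<Sum>i\<in>F - insert j D. c i * Y i w)" for w
    have [measurable]: "S \<in> borel_measurable P" "T \<in> borel_measurable Q"
      unfolding S_def T_def by measurable
    have FD: "F - D = insert j (F - insert j D)" using insert by auto
    have "(LINT w|P. (\<Prod>i\<in>D. indicator (B i) (X i w)) *\<^sub>R cis (t * X j w + s * S w))
      = (LINT w|Q. (\<Prod>i\<in>D. indicator (B i) (Y i w)) *\<^sub>R cis (t * Y j w + s * T w))" for t s
    proof -
      \<comment> \<open>The induction hypothesis holds for all coefficients; giving \<open>t\<close>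
        to \<open>j\<close> and rescaling the others by \<open>s\<close> produces the two-parameter
        family that tilting asks for.\<close>
      have *: "(\<Sum>i\<in>F-D. (if i = j then t else s * c i) * Z i w) = t * Z j w + s * (\<Sum>i\<in>F - insert j D. c i * Z i w)"
        for Z :: "'i \<Rightarrow> 'c \<Rightarrow> real" and w
        unfolding FD using F by (subst sum.insert) (auto simp: sum_distrib_left mult_ac intro!: sum.cong)
      show ?thesis
        using insert.IH[of "\<lambda>i. if i = j then t else s * c i"] insert.prems by (simp add: * S_def T_def)
    qed
    then have "(LINT w|P. ((\<Prod>i\<in>D. indicator (B i) (X i w)) * indicator (B j) (X j w)) *\<^sub>R cis (S w))
      = (LINT w|Q. ((\<Prod>i\<in>D. indicator (B i) (Y i w)) * indicator (B j) (Y j w)) *\<^sub>R cis (T w))"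
      by (intro tilted_char_unique[OF P Q]) (auto intro!: prod_nonneg prod_le_1)
    then show ?case using insert.hyps by (simp add: S_def T_def mult.commute)
  qed
  from this[of F "\<lambda>_. 0"]
  have "complex_of_real (LINT w|P. (\<Prod>i\<in>F. indicator (B i) (X i w))) = complex_of_real (LINT w|Q. (\<Prod>i\<in>F. indicator (B i) (Y i w)))"
    by (simp add: scaleR_conv_of_real del: of_real_prod)
  moreover have prod: "(LINT w|R. (\<Prod>i\<in>F. indicator (B i) (Z i w))) = measure R {w\<in>space R. \<forall>i\<in>F. Z i w \<in> B i}"
    if "\<And>i. Z i \<in> borel_measurable R" "prob_space R" for Z :: "'i \<Rightarrow> 'c \<Rightarrow> real" and R
  proof -
    interpret prob_space R by fact
    note that(1) [measurable]
    have "(LINT w|R. (\<Prod>i\<in>F. indicator (B i) (Z i w))) = (LINT w|R. indicat_real {w\<in>space R. \<forall>i\<in>F. Z i w \<in> B i} w)"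
    proof (rule Bochner_Integration.integral_cong[OF refl])
      fix w assume w: "w \<in> space R"
      show "(\<Prod>i\<in>F. indicator (B i) (Z i w)) = indicat_real {w\<in>space R. \<forall>i\<in>F. Z i w \<in> B i} w"
      proof (cases "\<forall>i\<in>F. Z i w \<in> B i")
        case False
        then have "\<exists>i\<in>F. indicat_real (B i) (Z i w) = 0" by (auto simp: indicator_def)
        then have "(\<Prod>i\<in>F. indicat_real (B i) (Z i w)) = 0" by (rule prod_zero[OF F])
        then show ?thesis using False by (auto simp: indicator_def)
      next
        case True
        then show ?thesis using w by simp
      qed
    qed
    then show ?thesis by (simp add: Int_absorb2)
  qed
  ultimately show ?thesis using prod[OF X P] prod[OF Y Q] by (simp only: of_real_eq_iff)
qed

section \<open>Simple random walk\<close>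

definition nbr_avg :: "((int ^ 'd::finite) \<Rightarrow> real) \<Rightarrow> (int ^ 'd) \<Rightarrow> real" where
  "nbr_avg f x = (\<Sum>i\<in>(UNIV::'d set). f (x - axis i 1) + f (x + axis i 1)) / (2 * real CARD('d))"

lemma srw_p_Suc: "srw_p (Suc n) = nbr_avg (srw_p n)"
  by (simp add: nbr_avg_def fun_eq_iff)

lemma nbr_avg_nonneg: "(\<And>x. 0 \<le> f x) \<Longrightarrow> 0 \<le> nbr_avg f x"
  unfolding nbr_avg_def by (intro divide_nonneg_nonneg sum_nonneg add_nonneg_nonneg) auto

lemma nbr_avg_add: "nbr_avg (\<lambda>y. f y + g y) x = nbr_avg f x + nbr_avg g x"
  unfolding nbr_avg_def by (simp add: sum.distrib add_divide_distrib[symmetric] algebra_simps)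

lemma nbr_avg_cmult: "nbr_avg (\<lambda>y. c * f y) x = c * nbr_avg f x"
  unfolding nbr_avg_def by (simp add: sum_distrib_left algebra_simps)

lemma nbr_avg_sum: "finite K \<Longrightarrow> nbr_avg (\<lambda>y. \<Sum>k\<in>K. f k y) x = (\<Sum>k\<in>K. nbr_avg (f k) x)"
proof (induction K rule: finite_induct)
  case empty
  show ?case by (simp add: nbr_avg_def)
qed (simp add: nbr_avg_add)

lemma nbr_avg_shift: "nbr_avg (\<lambda>y. f (y - a)) x = nbr_avg f (x - a)"
  unfolding nbr_avg_def by (simp add: algebra_simps)

text \<open>The average is a convex combination of translates, and a translate of a finite set is
  finite. Bounds over all finite sets stand in for sums over the lattice.\<close>

lemma nbr_avg_sum_le:
  fixes f :: "(int ^ 'd::finite) \<Rightarrow> real"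
  assumes bound: "\<And>S. finite S \<Longrightarrow> (\<Sum>x\<in>S. f x) \<le> B" and S: "finite S"
  shows "(\<Sum>x\<in>S. nbr_avg f x) \<le> B"
proof -
  have shift: "(\<Sum>x\<in>S. f (x + a)) \<le> B" for a
  proof -
    have "(\<Sum>x\<in>S. f (x + a)) = (\<Sum>x\<in>(\<lambda>x. x + a) ` S. f x)"
      by (subst sum.reindex) (auto simp: inj_on_def)
    then show ?thesis using bound[of "(\<lambda>x. x + a) ` S"] S by simp
  qed
  have "(\<Sum>x\<in>S. nbr_avg f x)
      = (\<Sum>i\<in>(UNIV::'d set). (\<Sum>x\<in>S. f (x + (- axis i 1))) + (\<Sum>x\<in>S. f (x + axis i 1))) / (2 * real CARD('d))"
    unfolding nbr_avg_def
    by (subst sum_divide_distrib[symmetric], subst sum.swap) (simp add: sum.distrib)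
  also have "\<dots> \<le> (\<Sum>i\<in>(UNIV::'d set). B + B) / (2 * real CARD('d))"
    by (intro divide_right_mono sum_mono add_mono shift) auto
  also have "\<dots> = B" by simp
  finally show ?thesis .
qed

lemma srw_p_nonneg: "0 \<le> srw_p n x"
  by (induction n arbitrary: x) (auto simp: srw_p_Suc nbr_avg_nonneg simp del: srw_p.simps(2))

lemma srw_p_sum_le_1: "finite S \<Longrightarrow> (\<Sum>x\<in>S. srw_p n x) \<le> 1"
proof (induction n arbitrary: S)
  case 0
  have "S \<inter> {x. x = 0} \<subseteq> {0}" by auto
  from card_mono[OF _ this] 0 show ?case by (simp add: sum.If_cases)
next
  case (Suc n)
  then show ?case unfolding srw_p_Suc by (intro nbr_avg_sum_le)
qed

lemma srw_p_minus: "srw_p n (- x) = srw_p n x"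
proof (induction n arbitrary: x)
  case (Suc n)
  have "srw_p n (- x - axis i 1) = srw_p n (x + axis i 1)" "srw_p n (- x + axis i 1) = srw_p n (x - axis i 1)" for i
    using Suc[of "x + axis i 1"] Suc[of "x - axis i 1"] by (simp_all add: algebra_simps)
  then show ?case by (simp add: add.commute)
qed auto

section \<open>Heat kernel bound\<close>

fun walk1 :: "nat \<Rightarrow> int \<Rightarrow> real" where
  "walk1 0 k = (if k = 0 then 1 else 0)"
| "walk1 (Suc n) k = (walk1 n (k - 1) + walk1 n (k + 1)) / 2"

lemma walk1_nonneg: "0 \<le> walk1 n k"
  by (induction n arbitrary: k) auto

lemma walk1_eq:
  "walk1 n k = (if even (int n + k) \<and> \<bar>k\<bar> \<le> int n then real (n choose nat ((int n + k) div 2)) / 2 ^ n else 0)"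
proof (induction n arbitrary: k)
  case 0
  then show ?case by auto
next
  case (Suc n)
  \<comment> \<open>Apart from wrong parity, points out of range and the two endpoints,
    \<open>k\<close> is reached by \<open>Suc j\<close> steps to the right and has both predecessors
    in range; only there is Pascal's rule required.\<close>
  consider "odd (int (Suc n) + k)" | "even (int (Suc n) + k)" "\<bar>k\<bar> > int (Suc n)"
    | "k = int (Suc n)" | "k = - int (Suc n)" | j where "k = 2 * int (Suc j) - int (Suc n)" "j < n"
  proof -
    assume *: "odd (int (Suc n) + k) \<Longrightarrow> thesis" "even (int (Suc n) + k) \<Longrightarrow> \<bar>k\<bar> > int (Suc n) \<Longrightarrow> thesis"
      "k = int (Suc n) \<Longrightarrow> thesis" "k = - int (Suc n) \<Longrightarrow> thesis"
      "\<And>j. k = 2 * int (Suc j) - int (Suc n) \<Longrightarrow> j < n \<Longrightarrow> thesis"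
    show thesis
    proof (cases "odd (int (Suc n) + k) \<or> \<bar>k\<bar> > int (Suc n) \<or> k = int (Suc n) \<or> k = - int (Suc n)")
      case False
      then have "even (int (Suc n) + k)" by blast
      then obtain m where m: "int (Suc n) + k = 2 * m" by (elim evenE)
      with False have "m \<ge> 1" "m \<le> n" by auto
      then show ?thesis using m by (intro *(5)[of "nat (m - 1)"]) auto
    qed (use * in blast)
  qed
  then show ?case
  proof cases
    case 5
    have 1: "int n + (k - 1) = 2 * int j" "int n + (k + 1) = 2 * int (Suc j)" "int (Suc n) + k = 2 * int (Suc j)"
      using 5 by simp_all
    have 2: "\<bar>k - 1\<bar> \<le> int n" "\<bar>k + 1\<bar> \<le> int n" "\<bar>k\<bar> \<le> int (Suc n)" using 5 by auto
    show ?thesis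
      unfolding walk1.simps Suc 1 using 2 by (simp add: nat_mult_distrib nat_add_distrib field_simps)
  next
    case 3
    then have "nat ((int (Suc n) + k) div 2) = Suc n" by simp
    with 3 show ?thesis by (simp add: Suc)
  qed (auto simp: Suc)
qed

text \<open>For \<open>n = 2 m\<close> the square times \<open>2 m + 1\<close> is non-increasing in
  \<open>m\<close>, with successive ratio \<open>(2 m + 1) (2 m + 3) / (2 m + 2)^2\<close>. An odd
  \<open>n\<close> has the same normalised coefficient as \<open>n + 1\<close>.\<close>

lemma central_binomial_bound: "real (n choose (n div 2)) / 2 ^ n \<le> 1 / sqrt (real n + 1)"
proof -
  have even: "(real (2 * m choose m) / 4 ^ m)\<^sup>2 * (2 * real m + 1) \<le> 1" for m
  proof (induction m)
    case (Suc m)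
    have "real (Suc m) * real (2 * Suc m choose Suc m) = 2 * (2 * real m + 1) * real (2 * m choose m)"
    proof -
      have "Suc m * (2 * Suc m choose Suc m) = 2 * Suc m * (Suc (2 * m) choose m)"
        using Suc_times_binomial[of m "Suc (2 * m)"] by simp
      moreover have "Suc m * (Suc (2 * m) choose m) = Suc (2 * m) * (2 * m choose m)"
        using binomial_symmetric[of m "Suc (2 * m)"] Suc_times_binomial[of m "2 * m"] by simp
      ultimately have "Suc m * (2 * Suc m choose Suc m) = 2 * (Suc (2 * m) * (2 * m choose m))"
        by (simp only: mult.assoc)
      then have "real (Suc m * (2 * Suc m choose Suc m)) = real (2 * (Suc (2 * m) * (2 * m choose m)))"
        by (rule arg_cong)
      then show ?thesis by (simp only: of_nat_mult of_nat_Suc of_nat_numeral) (simp add: algebra_simps)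
    qed
    then have *: "real (2 * Suc m choose Suc m) / 4 ^ Suc m
        = (real (2 * m choose m) / 4 ^ m) * ((2 * real m + 1) / (2 * real m + 2))"
      by (simp add: divide_simps del: binomial_Suc_Suc mult_Suc_right) (simp add: algebra_simps del: binomial_Suc_Suc mult_Suc_right)
    have "(real (2 * Suc m choose Suc m) / 4 ^ Suc m)\<^sup>2 * (2 * real (Suc m) + 1)
      = ((real (2 * m choose m) / 4 ^ m)\<^sup>2 * (2 * real m + 1)) * ((2 * real m + 1) * (2 * real m + 3) / (2 * real m + 2)\<^sup>2)"
      unfolding * by (simp add: field_simps power2_eq_square)
    also have "\<dots> \<le> 1 * 1"
      by (intro mult_mono Suc) (auto simp: divide_simps power2_eq_square algebra_simps add_nonneg_nonneg not_less)
    finally show ?case by simp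
  qed simp
  have even': "real (2 * m choose m) / 4 ^ m \<le> 1 / sqrt (2 * real m + 1)" for m
  proof -
    have "real (2 * m choose m) / 4 ^ m * sqrt (2 * real m + 1) \<le> 1"
      by (rule power2_le_imp_le) (use even[of m] in \<open>simp_all add: power_mult_distrib power_divide\<close>)
    then show ?thesis by (simp add: field_simps)
  qed
  show ?thesis
  proof (cases "even n")
    case True
    then obtain m where "n = 2 * m" by (elim evenE)
    then show ?thesis using even'[of m] by (simp add: power_mult add.commute)
  next
    case False
    then obtain m where n: "n = Suc (2 * m)" by (elim oddE) simp
    have "2 * Suc m choose Suc m = 2 * (Suc (2 * m) choose m)"
    proof -
      have "Suc m * (2 * Suc m choose Suc m) = Suc m * (2 * (Suc (2 * m) choose m))"
        using Suc_times_binomial[of m "Suc (2 * m)"] by simp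
      then show ?thesis by (simp only: mult_cancel1) simp
    qed
    then have "real (n choose (n div 2)) / 2 ^ n = real (2 * Suc m choose Suc m) / 4 ^ Suc m"
      using n by (simp add: power_mult del: binomial_Suc_Suc mult_Suc_right)
    also have "\<dots> \<le> 1 / sqrt (2 * real (Suc m) + 1)" by (rule even')
    also have "\<dots> \<le> 1 / sqrt (real n + 1)" using n by (simp add: frac_le)
    finally show ?thesis .
  qed
qed

lemma walk1_le: "walk1 n k \<le> 1 / sqrt (real n + 1)"
proof -
  have "real (n choose j) / 2 ^ n \<le> 1 / sqrt (real n + 1)" for j
  proof -
    have "real (n choose j) / 2 ^ n \<le> real (n choose (n div 2)) / 2 ^ n"
      using binomial_maximum[of n j] by (simp add: divide_right_mono)
    then show ?thesis using central_binomial_bound[of n] by linarith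
  qed
  then show ?thesis by (simp add: walk1_eq)
qed

section \<open>Exponential generating functions of the walk\<close>

unbundle fps_syntax

lemma fps_deriv_prod:
  fixes f :: "'i \<Rightarrow> ('a::comm_ring_1) fps"
  assumes "finite A"
  shows "fps_deriv (\<Prod>i\<in>A. f i) = (\<Sum>i\<in>A. fps_deriv (f i) * (\<Prod>j\<in>A - {i}. f j))"
  using assms
proof (induction A rule: finite_induct)
  case (insert k A)
  have "(\<Prod>j\<in>insert k A - {i}. f j) = f k * (\<Prod>j\<in>A - {i}. f j)" if "i \<in> A" for i
  proof -
    have "insert k A - {i} = insert k (A - {i})" using insert that by auto
    then show ?thesis using insert by simp
  qed
  moreover have "insert k A - {k} = A" using insert by auto
  ultimately show ?case
    using insert by (simp add: sum_distrib_left mult_ac)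
qed simp

lemma fps_mult_nth_mono:
  fixes f f' g g' :: "real fps"
  assumes "\<And>n. 0 \<le> f $ n" "\<And>n. f $ n \<le> f' $ n" "\<And>n. 0 \<le> g $ n" "\<And>n. g $ n \<le> g' $ n"
  shows "0 \<le> (f * g) $ n \<and> (f * g) $ n \<le> (f' * g') $ n"
proof -
  have "0 \<le> f' $ n" for n using assms(1,2) order_trans by blast
  with assms show ?thesis unfolding fps_mult_nth by (auto intro!: sum_nonneg sum_mono mult_mono)
qed

lemma fps_prod_nth_mono:
  fixes f f' :: "'i \<Rightarrow> real fps"
  assumes "finite A" "\<And>i n. i \<in> A \<Longrightarrow> 0 \<le> f i $ n" "\<And>i n. i \<in> A \<Longrightarrow> f i $ n \<le> f' i $ n"
  shows "0 \<le> (\<Prod>i\<in>A. f i) $ n \<and> (\<Prod>i\<in>A. f i) $ n \<le> (\<Prod>i\<in>A. f' i) $ n"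
  using assms
proof (induction A arbitrary: n rule: finite_induct)
  case (insert k A)
  have "0 \<le> (f k * (\<Prod>i\<in>A. f i)) $ n \<and> (f k * (\<Prod>i\<in>A. f i)) $ n \<le> (f' k * (\<Prod>i\<in>A. f' i)) $ n"
    by (rule fps_mult_nth_mono) (use insert in auto)
  then show ?case using insert by simp
qed (auto simp: fps_one_nth)

lemma fps_prod_nth0: "(\<Prod>i\<in>A. f i) $ 0 = (\<Prod>i\<in>A. (f i :: 'a::comm_ring_1 fps) $ 0)"
  by (induction A rule: infinite_finite_induct) simp_all

definition walk1_egf :: "int \<Rightarrow> real fps" where
  "walk1_egf k = Abs_fps (\<lambda>n. walk1 n k / fact n)"

lemma fps_deriv_walk1_egf:
  "fps_deriv (walk1_egf k) = fps_const (1/2) * (walk1_egf (k - 1) + walk1_egf (k + 1))"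
proof (rule fps_ext)
  fix n
  have "real (Suc n) * (a / (2 * fact (Suc n))) = a / (fact n * 2)" for a :: real
    by (simp add: divide_simps del: of_nat_Suc)
  then show "fps_deriv (walk1_egf k) $ n = (fps_const (1/2) * (walk1_egf (k - 1) + walk1_egf (k + 1))) $ n"
    by (simp add: walk1_egf_def add_divide_distrib distrib_left del: of_nat_Suc fact_Suc times_divide_eq_right)
qed

text \<open>Exponential generating functions turn the random choice of the coordinate that moves
  into independence of the coordinates.\<close>

lemma srw_p_egf:
  fixes x :: "int ^ 'd::finite"
  shows "(\<Prod>i\<in>UNIV. walk1_egf (x $ i)) $ n = real CARD('d) ^ n * srw_p n x / fact n"
proof (induction n arbitrary: x)
  case 0
  show ?case
  proof (cases "x = 0")
    case False
    then obtain i where "x $ i \<noteq> 0" by (auto simp: vec_eq_iff)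
    then have "\<exists>i\<in>UNIV. walk1_egf (x $ i) $ 0 = 0" by (auto simp: walk1_egf_def)
    then have "(\<Prod>i\<in>UNIV. walk1_egf (x $ i) $ 0) = 0" by (intro prod_zero) auto
    with False show ?thesis by (simp add: fps_prod_nth0)
  next
    case True
    then show ?thesis unfolding fps_prod_nth0 by (simp add: walk1_egf_def)
  qed
next
  case (Suc n)
  define G where "G x = (\<Prod>i\<in>(UNIV::'d set). walk1_egf (x $ i))" for x :: "int ^ 'd"
  have G: "walk1_egf (x $ i + s) * (\<Prod>j\<in>UNIV - {i}. walk1_egf (x $ j)) = G (x + axis i s)" for i s
  proof -
    have "G (x + axis i s) = walk1_egf ((x + axis i s) $ i) * (\<Prod>j\<in>UNIV - {i}. walk1_egf ((x + axis i s) $ j))"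
      unfolding G_def by (rule prod.remove) auto
    also have "(\<Prod>j\<in>UNIV - {i}. walk1_egf ((x + axis i s) $ j)) = (\<Prod>j\<in>UNIV - {i}. walk1_egf (x $ j))"
      by (intro prod.cong) (auto simp: axis_def)
    finally show ?thesis by (simp add: axis_def)
  qed
  have "axis i (- 1) = - axis i (1::int)" for i :: 'd by (simp add: axis_def vec_eq_iff)
  \<comment> \<open>By the product rule each summand moves exactly one coordinate, so the
    coefficients of \<open>G\<close> obey the recursion of \<open>srw_p\<close> up to the factor
    \<open>CARD('d)\<close> and the factorial.\<close>
  then have "fps_deriv (G x) = fps_const (1/2) * (\<Sum>i\<in>UNIV. G (x - axis i 1) + G (x + axis i 1))"
    using G[of _ "-1"] G[of _ 1]
    by (simp add: G_def[of x] fps_deriv_prod fps_deriv_walk1_egf sum_distrib_left sum.distrib distrib_left distrib_right mult.assoc)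
  then have "fps_deriv (G x) $ n = (\<Sum>i\<in>UNIV. G (x - axis i 1) $ n + G (x + axis i 1) $ n) / 2"
    by (simp add: fps_sum_nth)
  also have "\<dots> = real CARD('d) ^ Suc n * srw_p (Suc n) x / fact n"
    unfolding G_def Suc by (simp add: sum_distrib_left sum_divide_distrib algebra_simps add_divide_distrib)
  finally have "real (Suc n) * G x $ Suc n = real CARD('d) ^ Suc n * srw_p (Suc n) x / fact n"
    by (simp del: srw_p.simps)
  then show ?case unfolding G_def
    by (simp add: divide_simps del: srw_p.simps) (simp add: mult_ac del: srw_p.simps)
qed

text \<open>Three coordinates use \<open>walk1_le\<close>, the others the trivial bound 1. To keep
  the majorant explicit, the square roots are linearised around the target index: with
  \<open>a = sqrt (n + 1)\<close>, the arithmetic-geometric mean inequality gives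
  \<open>1 / sqrt (l + 1) \<le> a / 2 / (l + 1) + 1 / (2 * a)\<close>. This leads to an exponential
  times \<open>L ^ 3\<close>, whose four terms all contribute order \<open>1 / a ^ 3\<close>; their
  constants add up to the cube in the statement.\<close>

lemma srw_p_le:
  fixes x :: "int ^ 'd::finite"
  assumes d: "CARD('d) \<ge> 3"
  shows "srw_p n x \<le> ((real CARD('d) + 1) / 2) ^ 3 / sqrt (real n + 1) ^ 3"
proof -
  define a where "a = sqrt (real n + 1)"
  have a: "a > 0" "a\<^sup>2 = real n + 1" by (auto simp: a_def)
  define L where "L = fps_const (a / 2) + fps_const (1 / (2 * a)) * fps_X"
  have E: "walk1_egf k $ m \<le> fps_exp 1 $ m" for k m
  proof -
    have "1 / sqrt (real m + 1) \<le> 1" by simp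
    then have "walk1 m k \<le> 1" using walk1_le[of m k] by linarith
    then show ?thesis by (simp add: walk1_egf_def divide_right_mono)
  qed
  \<comment> \<open>After the shift by \<open>fps_X\<close>, the bound
    \<open>1 / (l + 1) / fact l\<close> is the exponential coefficient at the same index
    \<open>Suc l\<close>; three such shifts lead to the coefficient \<open>n + 3\<close>
    below.\<close>
  have EL: "(fps_X * walk1_egf k) $ m \<le> (fps_exp 1 * L) $ m" for k m
  proof (cases m)
    case 0
    then show ?thesis using a by (simp add: L_def)
  next
    case (Suc l)
    have "1 / sqrt (real l + 1) \<le> a / 2 / (real l + 1) + 1 / (2 * a)"
    proof -
      define s where "s = sqrt (real l + 1)"
      have s: "s > 0" "real l + 1 = s\<^sup>2" by (auto simp: s_def)
      have "0 \<le> (a - s)\<^sup>2 / (2 * a * s\<^sup>2)" using a s by simp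
      also have "\<dots> = a / 2 / s\<^sup>2 + 1 / (2 * a) - 1 / s"
        using a(1) s(1) by (simp add: field_simps power2_eq_square)
      finally show ?thesis unfolding s_def[symmetric] unfolding s(2) by simp
    qed
    with walk1_le[of l k] have "walk1 l k \<le> a / 2 / (real l + 1) + 1 / (2 * a)" by linarith
    then have "walk1 l k / fact l \<le> (a / 2 / (real l + 1) + 1 / (2 * a)) / fact l"
      by (intro divide_right_mono) auto
    also have "\<dots> = a / 2 / fact (Suc l) + 1 / (2 * a) / fact l"
      by (simp add: add_divide_distrib mult.commute)
    also have "\<dots> = (fps_exp 1 * L) $ m"
    proof -
      have "fps_exp 1 * L = fps_const (a / 2) * fps_exp 1 + fps_const (1 / (2 * a)) * (fps_X * fps_exp 1)"
        by (simp only: L_def) (simp only: algebra_simps)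
      then show ?thesis by (simp add: Suc algebra_simps)
    qed
    finally show ?thesis unfolding Suc by (simp add: walk1_egf_def)
  qed
  obtain S :: "'d set" where S: "card S = 3" using d obtain_subset_with_card_n[of 3 "UNIV :: 'd set"] by auto
  define f where "f i = (if i \<in> S then fps_X * walk1_egf (x $ i) else walk1_egf (x $ i))" for i
  define f' where "f' i = (if i \<in> S then fps_exp 1 * L else fps_exp (1::real))" for i
  have split: "(\<Prod>i\<in>UNIV. g i) = (\<Prod>i\<in>S. g i) * (\<Prod>i\<in>-S. g i)" for g :: "'d \<Rightarrow> real fps"
    using prod.union_disjoint[of S "-S" g] by (simp add: Compl_partition)
  have cS: "card (-S) = CARD('d) - 3" using S by (simp add: Compl_eq_Diff_UNIV card_Diff_subset)
  have pf: "(\<Prod>i\<in>UNIV. f i) = fps_X ^ 3 * (\<Prod>i\<in>UNIV. walk1_egf (x $ i))"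
  proof -
    have "(\<Prod>i\<in>S. f i) = (\<Prod>i\<in>S. fps_X * walk1_egf (x $ i))" "(\<Prod>i\<in>-S. f i) = (\<Prod>i\<in>-S. walk1_egf (x $ i))"
      by (auto simp: f_def intro!: prod.cong)
    then show ?thesis unfolding split[of f] split[of "\<lambda>i. walk1_egf (x $ i)"] using S
      by (simp add: prod.distrib mult.assoc)
  qed
  have exps: "fps_exp (1::real) ^ 3 * fps_exp 1 ^ (CARD('d) - 3) = fps_exp 1 ^ CARD('d)"
    using d by (simp flip: power_add)
  have pf': "(\<Prod>i\<in>UNIV. f' i) = fps_exp (real CARD('d)) * L ^ 3"
  proof -
    have "(\<Prod>i\<in>S. f' i) = (\<Prod>i\<in>S. fps_exp 1 * L)" "(\<Prod>i\<in>-S. f' i) = (\<Prod>i\<in>-S. fps_exp 1)"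
      by (auto simp: f'_def intro!: prod.cong)
    then have "(\<Prod>i\<in>UNIV. f' i) = (fps_exp 1 ^ 3 * fps_exp 1 ^ (CARD('d) - 3)) * L ^ 3"
      unfolding split[of f'] using S cS by (simp add: power_mult_distrib)
    also have "\<dots> = fps_exp (real CARD('d)) * L ^ 3"
      unfolding exps by (simp add: fps_exp_power_mult)
    finally show ?thesis .
  qed
  have "0 \<le> walk1_egf k $ m" for k m by (simp add: walk1_egf_def walk1_nonneg)
  then have "(\<Prod>i\<in>UNIV. f i) $ (n + 3) \<le> (\<Prod>i\<in>UNIV. f' i) $ (n + 3)"
    using E EL by (intro fps_prod_nth_mono[THEN conjunct2]) (auto simp: f_def f'_def fps_X_mult_nth)
  then have le: "real CARD('d) ^ n * srw_p n x / fact n \<le> (fps_exp (real CARD('d)) * L ^ 3) $ (n + 3)"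
    unfolding pf pf' by (simp add: fps_X_power_mult_nth srw_p_egf)
  define D where "D = real CARD('d)"
  have D: "D > 0" by (simp add: D_def)
  define fc where "fc = fps_const (a / 2)" 
  define gc where "gc = fps_const (1 / (2 * a))"
  have L3: "L ^ 3 = fps_const (a^3 / 8) + fps_const (3 * a / 8) * fps_X + fps_const (3 / (8 * a)) * fps_X^2 + fps_const (1 / (8 * a^3)) * fps_X^3"
  proof -
    have "L ^ 3 = fc ^ 3 + (3 * fc^2 * gc) * fps_X + (3 * fc * gc^2) * fps_X^2 + gc^3 * fps_X^3"
      unfolding L_def fc_def[symmetric] gc_def[symmetric] by (simp add: power3_eq_cube power2_eq_square algebra_simps)
    moreover have "fc ^ 3 = fps_const (a^3 / 8)" "gc ^ 3 = fps_const (1 / (8 * a^3))"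
      by (simp_all add: fc_def gc_def fps_const_power power_divide power_mult_distrib)
    moreover have "3 * fc^2 * gc = fps_const (3 * a / 8)" "3 * fc * gc^2 = fps_const (3 / (8 * a))"
      using a(1) by (simp_all add: fc_def gc_def numeral_fps_const fps_const_power field_simps power2_eq_square)
    ultimately show ?thesis by simp
  qed
  have "(fps_exp D * L ^ 3) $ (n + 3)
    = a^3 / 8 * (D ^ (n+3) / fact (n+3)) + 3 * a / 8 * (D ^ (n+2) / fact (n+2))
      + 3 / (8 * a) * (D ^ (n+1) / fact (n+1)) + 1 / (8 * a^3) * (D ^ n / fact n)"
  proof -
    have coef: "(fps_exp D * (fps_const c * fps_X ^ k)) $ m = c * (D ^ j / fact j)" if "m = j + k" for c m j k
    proof -
      have *: "fps_exp D * (fps_const c * fps_X ^ k) = fps_const c * (fps_X ^ k * fps_exp D)"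
        by (simp only: mult_ac)
      show ?thesis unfolding * that fps_mult_left_const_nth fps_X_power_mult_nth by simp
    qed
    have "n + 3 = (n + 3) + 0" "n + 3 = (n + 2) + 1" "n + 3 = (n + 1) + 2" by simp_all
    note coefs = coef[OF this(1)] coef[OF this(2)] coef[OF this(3)] coef[of "n + 3" n 3, OF refl]
    show ?thesis
      unfolding L3 distrib_left fps_add_nth coefs(2)[unfolded power_one_right] coefs(3,4)
        coefs(1)[unfolded power_0 mult_1_right] by (rule refl)
  qed
  also have "\<dots> \<le> D ^ n / fact n * (((D + 1) / 2) ^ 3 / a ^ 3)"
  proof -
    have f1: "D ^ (n+1) / fact (n+1) = D ^ n / fact n * (D / a^2)"
      using a by (simp add: divide_simps)
    have "fact n * (a^2 * a^2) \<le> (fact (n+2) :: real)" "fact n * (a^2 * (a^2 * a^2)) \<le> (fact (n+3) :: real)"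
      unfolding a(2) by (auto simp: eval_nat_numeral mult_ac intro!: mult_mono)
    then have f2: "D ^ (n+2) / fact (n+2) \<le> D ^ n / fact n * (D^2 / a^4)"
      and f3: "D ^ (n+3) / fact (n+3) \<le> D ^ n / fact n * (D^3 / a^6)"
      using a(1) D by (auto simp: power_add eval_nat_numeral mult_ac intro!: frac_le)
    have "a^3 / 8 * (D ^ (n+3) / fact (n+3)) + 3 * a / 8 * (D ^ (n+2) / fact (n+2))
      + 3 / (8 * a) * (D ^ (n+1) / fact (n+1)) + 1 / (8 * a^3) * (D ^ n / fact n)
     \<le> a^3 / 8 * (D ^ n / fact n * (D^3 / a^6)) + 3 * a / 8 * (D ^ n / fact n * (D^2 / a^4))
      + 3 / (8 * a) * (D ^ n / fact n * (D / a^2)) + 1 / (8 * a^3) * (D ^ n / fact n)"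
      unfolding f1 by (intro add_mono mult_left_mono f2 f3) (use a(1) D in auto)
    also have "\<dots> = D ^ n / fact n * (((D + 1) / 2) ^ 3 / a ^ 3)"
    proof -
      have *: "a^3 * (D^3 / a^6) = D^3 / a^3" "a * (D^2 / a^4) = D^2 / a^3" "1 / a * (D / a^2) = D / a^3"
        using a(1) by (simp_all add: divide_simps eval_nat_numeral)
      have e1: "a^3 / 8 * (q * (D^3 / a^6)) + 3 * a / 8 * (q * (D^2 / a^4))
      + 3 / (8 * a) * (q * (D / a^2)) + 1 / (8 * a^3) * q
        = q / 8 * (a^3 * (D^3 / a^6) + 3 * (a * (D^2 / a^4)) + 3 * (1 / a * (D / a^2)) + 1 / a^3)" for q
        by (simp add: algebra_simps)
      have e2: "q / 8 * (a^3 * (D^3 / a^6) + 3 * (a * (D^2 / a^4)) + 3 * (1 / a * (D / a^2)) + 1 / a^3)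
        = q * (((D + 1) / 2) ^ 3 / a ^ 3)" for q
        unfolding * by (simp add: add_divide_distrib[symmetric] power_divide) (simp add: power3_eq_cube power2_eq_square algebra_simps)
      show ?thesis by (rule trans[OF e1 e2])
    qed
    finally show ?thesis .
  qed
  finally have "D ^ n / fact n * srw_p n x \<le> D ^ n / fact n * (((D + 1) / 2) ^ 3 / a ^ 3)"
    using le by (simp add: D_def)
  moreover have "0 < D ^ n / fact n" using D by simp
  ultimately have "srw_p n x \<le> ((D + 1) / 2) ^ 3 / a ^ 3" by (rule mult_left_le_imp_le)
  then show ?thesis by (simp add: D_def a_def)
qed

unbundle no fps_syntax

section \<open>The Green's function\<close>

text \<open>The terms are dominated by differences of \<open>2 / sqrt k\<close>, so the sum
  telescopes.\<close>

lemma sum_inverse_sqrt_cube_le: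
  assumes "M \<ge> 1"
  shows "(\<Sum>n<m. 1 / sqrt (real (n + M) + 1) ^ 3) \<le> 2 / sqrt (real M)"
proof -
  have "(\<Sum>n<m. 1 / sqrt (real (n + M) + 1) ^ 3) \<le> 2 / sqrt (real M) - 2 / sqrt (real (m + M))"
  proof (induction m)
    case (Suc m)
    define k where "k = real (m + M)"
    have k: "k > 0" using assms by (simp add: k_def)
    define p q where "p = sqrt k" and "q = sqrt (k + 1)"
    have pq: "0 < p" "p \<le> q" "q\<^sup>2 = p\<^sup>2 + 1" using k by (auto simp: p_def q_def)
    have "1 / q ^ 3 \<le> 2 / p - 2 / q"
    proof -
      have "(q - p) * (q + p) = 1" using pq by (simp add: power2_eq_square algebra_simps)
      then have "1 / (q + p) = q - p" using pq by (simp add: field_simps)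
      then have "2 / p - 2 / q = 2 / (p * q * (q + p))"
        using pq by (simp add: divide_simps) (simp add: algebra_simps)
      moreover have "p * q * (q + p) \<le> q * q * (q + q)" using pq by (intro mult_mono add_mono) auto
      then have "2 / (q * q * (q + q)) \<le> 2 / (p * q * (q + p))" using pq by (intro divide_left_mono) auto
      moreover have "2 / (q * q * (q + q)) = 1 / q ^ 3" using pq by (simp add: divide_simps power3_eq_cube)
      ultimately show ?thesis by simp
    qed
    with Suc show ?case by (simp add: p_def q_def k_def add_ac)
  qed simp
  then show ?thesis by (rule order_trans) simp
qed

lemma summable_inverse_sqrt_cube: "summable (\<lambda>n. 1 / sqrt (real n + 1) ^ 3)"
proof -
  have "summable (\<lambda>n. 1 / sqrt (real (n + 1) + 1) ^ 3)"
    by (rule summableI_nonneg_bounded[where x = "2 / sqrt 1"])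
       (use sum_inverse_sqrt_cube_le[of 1] in auto)
  then show ?thesis by (subst (asm) summable_iff_shift)
qed

lemma srw_p_summable:
  fixes x :: "int ^ 'd::finite"
  assumes "CARD('d) \<ge> 3"
  shows "summable (\<lambda>n. srw_p n x)"
  by (rule summable_comparison_test'[OF summable_mult[OF summable_inverse_sqrt_cube], of 0 _ "((real CARD('d) + 1) / 2) ^ 3"])
     (simp add: abs_of_nonneg[OF srw_p_nonneg] srw_p_le[OF assms])

lemma green_nonneg: "CARD('d) \<ge> 3 \<Longrightarrow> 0 \<le> green (x :: int ^ 'd::finite)"
  unfolding green_def by (intro suminf_nonneg srw_p_summable srw_p_nonneg)

lemma green_minus: "green (- x) = green x"
  unfolding green_def by (simp add: srw_p_minus)

lemma green_0_ge_1: "CARD('d) \<ge> 3 \<Longrightarrow> 1 \<le> green (0 :: int ^ 'd::finite)"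
  unfolding green_def using sum_le_suminf[OF srw_p_summable, of "{0}" 0] by (simp add: srw_p_nonneg)

text \<open>Sum the Green's function over a finite part \<open>S\<close> of the level set. Each of
  the first \<open>M\<close> times contributes at most 1 in total, and each tail after
  \<open>M\<close> is at most \<open>s / 2\<close> once \<open>M\<close> is of order
  \<open>1 / s^2\<close>. Hence \<open>s * card S / 2 \<le> M\<close>, which gives the exponent
  3.\<close>

lemma green_level_set:
  assumes d: "CARD('d::finite) \<ge> 3"
  obtains K where "K > 0" "\<And>s. 0 < s \<Longrightarrow> s \<le> 1 \<Longrightarrow> finite {x :: int ^ 'd. s \<le> green x}"
    "\<And>s. 0 < s \<Longrightarrow> s \<le> 1 \<Longrightarrow> real (card {x :: int ^ 'd. s \<le> green x}) \<le> K / s ^ 3"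
proof -
  define C where "C = ((real CARD('d) + 1) / 2) ^ 3"
  have C: "C > 0" by (simp add: C_def)
  have tail: "(\<Sum>n. srw_p (n + M) x) \<le> C * (2 / sqrt (real M))" if "M \<ge> 1" for M and x :: "int ^ 'd"
  proof (rule suminf_le_const)
    show "summable (\<lambda>n. srw_p (n + M) x)" by (subst summable_iff_shift) (rule srw_p_summable[OF d])
    fix m
    have "(\<Sum>n<m. srw_p (n + M) x) \<le> (\<Sum>n<m. C * (1 / sqrt (real (n + M) + 1) ^ 3))"
    proof (rule sum_mono)
      fix n
      show "srw_p (n + M) x \<le> C * (1 / sqrt (real (n + M) + 1) ^ 3)"
        using srw_p_le[OF d, of "n + M" x] by (simp add: C_def)
    qed
    also have "\<dots> \<le> C * (2 / sqrt (real M))"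
      unfolding sum_distrib_left[symmetric] using C sum_inverse_sqrt_cube_le[OF that] by (intro mult_left_mono) auto
    finally show "(\<Sum>n<m. srw_p (n + M) x) \<le> C * (2 / sqrt (real M))" .
  qed
  define K where "K = 2 * (16 * C\<^sup>2 + 2)"
  have bound: "real (card S) \<le> K / s ^ 3"
    if s: "0 < s" "s \<le> 1" and S: "finite S" "S \<subseteq> {x :: int ^ 'd. s \<le> green x}" for s S
  proof -
    \<comment> \<open>From \<open>16 * C^2 / s^2\<close> on, \<open>2 * C / sqrt M\<close> is at
      most \<open>s / 2\<close>; the summand 1 keeps \<open>M\<close> positive.\<close>
    define M where "M = nat \<lceil>16 * C\<^sup>2 / s\<^sup>2\<rceil> + 1"
    have "0 \<le> 16 * C\<^sup>2 / s\<^sup>2" using s by simp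
    then have M: "1 \<le> M" "16 * C\<^sup>2 / s\<^sup>2 \<le> real M" "real M \<le> 16 * C\<^sup>2 / s\<^sup>2 + 2"
      unfolding M_def by linarith+
    have "4 * C / s \<le> sqrt (real M)"
      using M(2) by (intro real_le_rsqrt) (simp add: power_divide power_mult_distrib)
    then have tailM: "C * (2 / sqrt (real M)) \<le> s / 2"
      using s M(1) by (simp add: field_simps)
    have "s * real (card S) = (\<Sum>x\<in>S. s)" by simp
    also have "\<dots> \<le> (\<Sum>x\<in>S. green x)" using S by (intro sum_mono) auto
    also have "\<dots> \<le> (\<Sum>x\<in>S. (\<Sum>n<M. srw_p n x) + s / 2)"
    proof (rule sum_mono)
      fix x :: "int ^ 'd"
      show "green x \<le> (\<Sum>n<M. srw_p n x) + s / 2"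
        unfolding green_def using tail[OF M(1), of x] tailM suminf_split_initial_segment[OF srw_p_summable[OF d], of x M] by simp
    qed
    also have "\<dots> = (\<Sum>n<M. \<Sum>x\<in>S. srw_p n x) + real (card S) * (s / 2)"
      by (simp add: sum.distrib sum.swap[of _ _ S])
    also have "\<dots> \<le> (\<Sum>n<M. 1) + real (card S) * (s / 2)"
      by (intro add_mono sum_mono srw_p_sum_le_1 S) auto
    finally have "real (card S) * s \<le> 2 * real M" by (simp add: field_simps)
    also have "\<dots> \<le> K / s\<^sup>2"
    proof -
      have "s\<^sup>2 \<le> 1" using s by (simp add: power_le_one)
      then have "2 \<le> 2 / s\<^sup>2" using s by (simp add: field_simps)
      then show ?thesis using M(3) by (simp add: K_def add_divide_distrib)
    qed
    finally show ?thesis using s by (simp add: field_simps power2_eq_square power3_eq_cube)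
  qed
  show thesis
  proof (rule that)
    show "K > 0" by (simp add: K_def add_nonneg_pos)
    fix s :: real assume s: "0 < s" "s \<le> 1"
    show fin: "finite {x :: int ^ 'd. s \<le> green x}"
    proof (rule ccontr)
      assume inf: "infinite {x :: int ^ 'd. s \<le> green x}"
      obtain S where S: "finite S" "card S = nat \<lceil>K / s ^ 3\<rceil> + 1" "S \<subseteq> {x :: int ^ 'd. s \<le> green x}"
        using infinite_arbitrarily_large[OF inf] by blast
      have "K / s ^ 3 < real (card S)" unfolding S(2) by linarith
      with bound[OF s S(1,3)] show False by simp
    qed
    show "real (card {x :: int ^ 'd. s \<le> green x}) \<le> K / s ^ 3"
      by (rule bound[OF s fin]) simp
  qed
qed

section \<open>Hitting distributions and balayage\<close>

fun avoid_p :: "(int ^ 'd::finite) set \<Rightarrow> (int ^ 'd) \<Rightarrow> nat \<Rightarrow> (int ^ 'd) \<Rightarrow> real" where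
  "avoid_p F a 0 x = (if x = a then 1 else 0)"
| "avoid_p F a (Suc n) x = (if x \<in> F then 0 else nbr_avg (avoid_p F a n) x)"

text \<open>First entrance into \<open>F\<close> at time \<open>Suc n\<close>, at the point
  \<open>x\<close>. Time 0 is tested neither here nor in \<open>avoid_p\<close>.\<close>

definition hit_p :: "(int ^ 'd::finite) set \<Rightarrow> (int ^ 'd) \<Rightarrow> nat \<Rightarrow> (int ^ 'd) \<Rightarrow> real" where
  "hit_p F a n x = (if x \<in> F then nbr_avg (avoid_p F a n) x else 0)"

lemma avoid_p_nonneg: "0 \<le> avoid_p F a n x"
  by (induction n arbitrary: x) (auto intro: nbr_avg_nonneg)

lemma hit_p_nonneg: "0 \<le> hit_p F a n x"
  by (auto simp: hit_p_def intro: nbr_avg_nonneg avoid_p_nonneg)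

text \<open>Decomposition by the time \<open>Suc k\<close> and the place \<open>c\<close> of the
  first entrance, after which the remaining \<open>n - Suc k\<close> steps are unrestricted.\<close>

lemma first_passage:
  assumes "finite F"
  shows "srw_p n (x - a) = avoid_p F a n x + (\<Sum>k<n. \<Sum>c\<in>F. hit_p F a k c * srw_p (n - Suc k) (x - c))"
proof (induction n arbitrary: x)
  case (Suc n)
  have "srw_p (Suc n) (x - a) = nbr_avg (\<lambda>y. srw_p n (y - a)) x"
    by (simp only: srw_p_Suc nbr_avg_shift)
  also have "\<dots> = nbr_avg (avoid_p F a n) x
      + (\<Sum>k<n. \<Sum>c\<in>F. hit_p F a k c * nbr_avg (srw_p (n - Suc k)) (x - c))"
    unfolding Suc using assms by (simp add: nbr_avg_add nbr_avg_sum nbr_avg_cmult nbr_avg_shift)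
  also have "(\<Sum>k<n. \<Sum>c\<in>F. hit_p F a k c * nbr_avg (srw_p (n - Suc k)) (x - c))
      = (\<Sum>k<n. \<Sum>c\<in>F. hit_p F a k c * srw_p (Suc n - Suc k) (x - c))"
    by (intro sum.cong refl) (simp add: srw_p_Suc[symmetric] Suc_diff_Suc del: srw_p.simps)
  also have "nbr_avg (avoid_p F a n) x = avoid_p F a (Suc n) x + hit_p F a n x"
    by (simp add: hit_p_def)
  \<comment> \<open>The new summand \<open>k = n\<close> has no steps left, and
    \<open>srw_p 0\<close> picks out \<open>c = x\<close>.\<close>
  also have "hit_p F a n x = (\<Sum>c\<in>F. hit_p F a n c * srw_p (Suc n - Suc n) (x - c))"
    using assms by (simp add: sum.delta' if_distrib[of "\<lambda>u. _ * u"] cong: if_cong) (simp add: hit_p_def)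
  finally show ?case by (simp del: srw_p.simps avoid_p.simps)
qed simp

text \<open>Mass absorbed in \<open>F\<close> and mass still avoiding it never exceed 1 together.
  The induction measures the avoiding part on an arbitrary finite \<open>S\<close>; finally
  \<open>S = {}\<close>.\<close>

lemma hit_p_sum_le_1:
  assumes F: "finite F"
  shows "(\<Sum>k<n. \<Sum>c\<in>F. hit_p F a k c) \<le> 1"
proof -
  have "finite S \<Longrightarrow> (\<Sum>x\<in>S. avoid_p F a n x) + (\<Sum>k<n. \<Sum>c\<in>F. hit_p F a k c) \<le> 1" for S
  proof (induction n arbitrary: S)
    case 0
    then show ?case by (cases "a \<in> S") auto
  next
    case (Suc n)
    have "(\<Sum>x\<in>S. avoid_p F a (Suc n) x) = (\<Sum>x\<in>S - F. nbr_avg (avoid_p F a n) x)"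
      using Suc.prems by (intro sum.mono_neutral_cong_right) auto
    moreover have "(\<Sum>c\<in>F. hit_p F a n c) = (\<Sum>x\<in>F. nbr_avg (avoid_p F a n) x)"
      by (simp add: hit_p_def)
    moreover have "(\<Sum>x\<in>S - F. nbr_avg (avoid_p F a n) x) + (\<Sum>x\<in>F. nbr_avg (avoid_p F a n) x)
        = (\<Sum>x\<in>(S - F) \<union> F. nbr_avg (avoid_p F a n) x)"
      using Suc.prems F by (intro sum.union_disjoint[symmetric]) auto
    moreover have "\<dots> \<le> 1 - (\<Sum>k<n. \<Sum>c\<in>F. hit_p F a k c)"
      by (rule nbr_avg_sum_le) (use Suc.IH Suc.prems F in \<open>auto simp: algebra_simps\<close>)
    ultimately show ?case by simp
  qed
  from this[of "{}"] show ?thesis by simp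
qed

text \<open>The coefficients are the hitting distribution of \<open>F\<close> for the walk started at \<open>a\<close>.\<close>

lemma green_balayage:
  fixes a :: "int ^ 'd::finite"
  assumes d: "CARD('d) \<ge> 3" and F: "finite F" and a: "a \<notin> F"
  obtains h where "\<And>c. 0 \<le> h c" "(\<Sum>c\<in>F. h c) \<le> 1"
    "\<And>x. x \<in> F \<Longrightarrow> green (a - x) = (\<Sum>c\<in>F. h c * green (c - x))"
proof -
  have avoid_le: "avoid_p F a n x \<le> srw_p n (x - a)" for n x
  proof -
    have "0 \<le> (\<Sum>k<n. \<Sum>c\<in>F. hit_p F a k c * srw_p (n - Suc k) (x - c))"
      by (intro sum_nonneg mult_nonneg_nonneg hit_p_nonneg srw_p_nonneg)
    then show ?thesis using first_passage[OF F, of n x a] by linarith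
  qed
  have hit_le: "hit_p F a n c \<le> srw_p (Suc n) (c - a)" for n c
  proof -
    have "hit_p F a n c \<le> nbr_avg (avoid_p F a n) c"
      by (simp add: hit_p_def nbr_avg_nonneg avoid_p_nonneg)
    also have "\<dots> \<le> nbr_avg (\<lambda>y. srw_p n (y - a)) c"
      unfolding nbr_avg_def by (intro divide_right_mono sum_mono add_mono avoid_le) simp
    finally show ?thesis by (simp only: srw_p_Suc nbr_avg_shift)
  qed
  have sm: "summable (\<lambda>n. hit_p F a n c)" for c
  proof (rule summable_comparison_test')
    show "summable (\<lambda>n. srw_p (Suc n) (c - a))"
      using srw_p_summable[OF d] by (subst summable_Suc_iff)
    show "norm (hit_p F a n c) \<le> srw_p (Suc n) (c - a)" if "0 \<le> n" for n
      using hit_le hit_p_nonneg by (metis abs_of_nonneg real_norm_def)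
  qed
  define h where "h c = (\<Sum>n. hit_p F a n c)" for c
  show thesis
  proof (rule that)
    show "0 \<le> h c" for c unfolding h_def by (intro suminf_nonneg sm hit_p_nonneg)
    have "(\<Sum>c\<in>F. h c) = (\<Sum>n. \<Sum>c\<in>F. hit_p F a n c)"
      unfolding h_def by (rule suminf_sum[symmetric]) (rule sm)
    also have "\<dots> \<le> 1"
      by (rule suminf_le_const) (auto intro!: summable_sum sm hit_p_sum_le_1 F)
    finally show "(\<Sum>c\<in>F. h c) \<le> 1" .
    fix x assume x: "x \<in> F"
    \<comment> \<open>On \<open>F\<close> nothing avoids: at time 0 because
      \<open>a \<notin> F\<close>, later by definition. The first-passage formula becomes a pure
      convolution, which the Cauchy product sums.\<close>
    have avoid0: "avoid_p F a n x = 0" for n using x a by (cases n) auto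
    have conv: "(\<lambda>n. \<Sum>k\<le>n. hit_p F a k c * srw_p (n - k) (x - c)) sums (h c * green (x - c))" for c
      unfolding h_def green_def
      by (rule Cauchy_product_sums) (use sm srw_p_summable[OF d] in \<open>auto simp: hit_p_nonneg srw_p_nonneg\<close>)
    have "srw_p (Suc n) (x - a) = (\<Sum>c\<in>F. \<Sum>k\<le>n. hit_p F a k c * srw_p (n - k) (x - c))" for n
      using first_passage[OF F, of "Suc n" x a]
      by (simp add: avoid0 lessThan_Suc_atMost sum.swap[of _ _ F] del: srw_p.simps avoid_p.simps)
    then have "(\<lambda>n. srw_p (Suc n) (x - a)) sums (\<Sum>c\<in>F. h c * green (x - c))"
      using sums_sum[of F, OF conv] by (simp del: srw_p.simps)
    \<comment> \<open>This adds the term at time 0, which vanishes because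
      \<open>x \<noteq> a\<close>.\<close>
    from sums_Suc[OF this] have "(\<lambda>n. srw_p n (x - a)) sums (\<Sum>c\<in>F. h c * green (x - c))"
      using x a by (cases "x = a") (auto simp del: srw_p.simps(2))
    then have "green (x - a) = (\<Sum>c\<in>F. h c * green (x - c))"
      unfolding green_def by (rule sums_unique[symmetric])
    then show "green (a - x) = (\<Sum>c\<in>F. h c * green (c - x))"
      using green_minus[of "x - a"] green_minus[of "x - _"] by simp
  qed
qed

section \<open>The Gaussian tail\<close>

lemma std_normal_prob_space: "prob_space std_normal_distribution"
  using real_dist_normal_dist by (simp add: real_distribution_def)

definition gauss_tail :: "real \<Rightarrow> real" where
  "gauss_tail x = measure std_normal_distribution {x..}"

lemma gauss_tail_nonneg: "0 \<le> gauss_tail x"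
  by (simp add: gauss_tail_def)

lemma gauss_tail_antimono:
  assumes "x \<le> y"
  shows "gauss_tail y \<le> gauss_tail x"
proof -
  interpret real_distribution std_normal_distribution by (rule real_dist_normal_dist)
  show ?thesis unfolding gauss_tail_def using assms by (intro finite_measure_mono) auto
qed

lemma gauss_tail_measurable [measurable]: "gauss_tail \<in> borel_measurable borel"
proof -
  have "(\<lambda>x. - gauss_tail x) \<in> borel_measurable borel"
    by (rule borel_measurable_mono) (simp add: mono_def gauss_tail_antimono)
  then show ?thesis by simp
qed

lemma gauss_tail_le_1: "gauss_tail x \<le> 1"
  unfolding gauss_tail_def by (rule prob_space.prob_le_1[OF std_normal_prob_space])

text \<open>The function \<open>- std_normal_density t / t\<close> is an antiderivative of
  \<open>std_normal_density t * (1 + 1 / t^2)\<close>, so the latter integrates over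
  \<open>t \<ge> x\<close> to exactly \<open>std_normal_density x / x\<close>; on that range the
  extra factor lies between 1 and \<open>1 + 1 / x^2\<close>.\<close>

lemma gauss_tail_mills:
  assumes x: "x > 0"
  shows "gauss_tail x \<le> std_normal_density x / x"
    and "std_normal_density x / x \<le> (1 + 1 / x\<^sup>2) * gauss_tail x"
proof -
  interpret real_distribution std_normal_distribution by (rule real_dist_normal_dist)
  have tail: "(\<integral>\<^sup>+t. ennreal (std_normal_density t) * indicator {x..} t \<partial>lborel) = ennreal (gauss_tail x)"
    using emeasure_eq_measure[of "{x..}"] by (simp add: gauss_tail_def emeasure_density)
  have "((\<lambda>t. - (std_normal_density t / t)) \<longlongrightarrow> 0) at_top"
    unfolding std_normal_density_def by real_asymp
  then have "(\<integral>\<^sup>+t. ennreal (std_normal_density t * (1 + 1 / t\<^sup>2)) * indicator {x..} t \<partial>lborel)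
      = ennreal (0 - (- (std_normal_density x / x)))"
  proof (intro nn_integral_FTC_atLeast)
    fix t assume "x \<le> t"
    then have "t \<noteq> 0" using x by auto
    then have "((\<lambda>t. - (c * exp (- t\<^sup>2 / 2) / t)) has_real_derivative c * exp (- t\<^sup>2 / 2) * (1 + 1 / t\<^sup>2)) (at t)" for c
      by (auto intro!: derivative_eq_intros simp: field_simps power2_eq_square)
    then show "((\<lambda>t. - (std_normal_density t / t)) has_real_derivative std_normal_density t * (1 + 1 / t\<^sup>2)) (at t)"
      unfolding std_normal_density_def .
  qed auto
  then have mills: "(\<integral>\<^sup>+t. ennreal (std_normal_density t * (1 + 1 / t\<^sup>2)) * indicator {x..} t \<partial>lborel)
      = ennreal (std_normal_density x / x)" by simp
  have "ennreal (gauss_tail x) \<le> ennreal (std_normal_density x / x)"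
    unfolding mills[symmetric] tail[symmetric]
    by (intro nn_integral_mono mult_right_mono ennreal_leI) (simp_all add: distrib_left)
  then show "gauss_tail x \<le> std_normal_density x / x" using x by simp
  define k where "k = 1 + 1 / x\<^sup>2"
  have k: "k \<ge> 0" by (simp add: k_def add_nonneg_nonneg)
  have "ennreal (std_normal_density x / x)
      \<le> (\<integral>\<^sup>+t. ennreal k * (ennreal (std_normal_density t) * indicator {x..} t) \<partial>lborel)"
    unfolding mills[symmetric]
  proof (rule nn_integral_mono)
    fix t
    show "ennreal (std_normal_density t * (1 + 1 / t\<^sup>2)) * indicator {x..} t
      \<le> ennreal k * (ennreal (std_normal_density t) * indicator {x..} t)"
    proof (cases "x \<le> t")
      case True
      then have "1 / t\<^sup>2 \<le> 1 / x\<^sup>2" using x by (intro divide_left_mono power_mono) auto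
      then have "1 + 1 / t\<^sup>2 \<le> k" by (simp add: k_def)
      then have "std_normal_density t * (1 + 1 / t\<^sup>2) \<le> k * std_normal_density t"
        by (subst mult.commute) (intro mult_right_mono, auto)
      then show ?thesis using True k by (simp add: ennreal_mult[symmetric] ennreal_leI)
    qed simp
  qed
  also have "\<dots> = ennreal (k * gauss_tail x)"
    by (subst nn_integral_cmult) (simp_all add: tail k ennreal_mult gauss_tail_nonneg)
  finally show "std_normal_density x / x \<le> (1 + 1 / x\<^sup>2) * gauss_tail x"
    using k by (simp add: gauss_tail_nonneg k_def[symmetric])
qed

lemma gauss_tail_asymp:
  fixes x :: "nat \<Rightarrow> real"
  assumes x: "filterlim x at_top sequentially"
    and lim: "(\<lambda>N. real N * (std_normal_density (x N) / x N)) \<longlonglongrightarrow> l"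
  shows "(\<lambda>N. real N * gauss_tail (x N)) \<longlonglongrightarrow> l"
proof (rule tendsto_sandwich)
  have pos: "\<forall>\<^sub>F N in sequentially. x N > 0" using x by (simp add: filterlim_at_top_dense)
  show "\<forall>\<^sub>F N in sequentially. real N * gauss_tail (x N) \<le> real N * (std_normal_density (x N) / x N)"
    using pos by eventually_elim (intro mult_left_mono gauss_tail_mills, auto)
  show "\<forall>\<^sub>F N in sequentially. real N * (std_normal_density (x N) / x N) / (1 + 1 / (x N)\<^sup>2) \<le> real N * gauss_tail (x N)"
    using pos
  proof eventually_elim
    case (elim N)
    have "0 < 1 + 1 / (x N)\<^sup>2" by (simp add: add_pos_nonneg)
    moreover have "real N * (std_normal_density (x N) / x N) \<le> real N * ((1 + 1 / (x N)\<^sup>2) * gauss_tail (x N))"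
      by (intro mult_left_mono gauss_tail_mills(2)[OF elim]) auto
    ultimately show ?case by (subst pos_divide_le_eq) (simp_all only: mult_ac)
  qed
  have "((\<lambda>t::real. 1 + 1 / t\<^sup>2) \<longlongrightarrow> 1) at_top" by real_asymp
  then have "(\<lambda>N. 1 + 1 / (x N)\<^sup>2) \<longlonglongrightarrow> 1" using x by (rule filterlim_compose)
  from tendsto_divide[OF lim this]
  show "(\<lambda>N. real N * (std_normal_density (x N) / x N) / (1 + 1 / (x N)\<^sup>2)) \<longlonglongrightarrow> l" by simp
qed (rule lim)

section \<open>Tails at the normalised levels\<close>

definition norm_b :: "nat \<Rightarrow> real" where
  "norm_b N = sqrt (2 * ln (real N)) - (ln (ln (real N)) + ln (4 * pi)) / (2 * sqrt (2 * ln (real N)))"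

lemma dgff_b_eq: "dgff_b g N = sqrt g * norm_b N"
  by (simp add: dgff_b_def norm_b_def)

lemma norm_b_at_top: "filterlim norm_b at_top sequentially"
  unfolding norm_b_def by real_asymp

lemma eventually_ln_pos: "\<forall>\<^sub>F N in sequentially. 0 < ln (real N)"
  by real_asymp

lemma norm_b_eq:
  assumes "0 < ln (real N)" and w: "w = sqrt (2 * ln (real N))"
  shows "norm_b N = w - (2 * ln w + ln (2 * pi)) / (2 * w)"
proof -
  have "ln (4 * pi) = ln 2 + ln (2 * pi)" using ln_mult[of 2 "2 * pi"] by simp
  then have "2 * ln w + ln (2 * pi) = ln (ln (real N)) + ln (4 * pi)"
    using assms by (simp add: ln_sqrt ln_mult)
  then show ?thesis by (simp add: norm_b_def w)
qed

text \<open>Expressed in \<open>w = sqrt (2 ln N)\<close>, so that \<open>N = exp (w\<^sup>2 / 2)\<close>.\<close>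

lemma gauss_tail_limit:
  fixes y :: "real \<Rightarrow> real" and x :: "nat \<Rightarrow> real"
  assumes sq: "((\<lambda>w. w\<^sup>2 / 2 - (y w)\<^sup>2 / 2 - ln w) \<longlongrightarrow> ln (2 * pi) / 2 - c) at_top"
    and ratio: "((\<lambda>w. w / y w) \<longlongrightarrow> 1) at_top"
    and y: "filterlim y at_top at_top"
    and x: "\<And>N. 0 < ln (real N) \<Longrightarrow> x N = y (sqrt (2 * ln (real N)))"
  shows "(\<lambda>N. real N * gauss_tail (x N)) \<longlonglongrightarrow> exp (- c)"
proof (rule gauss_tail_asymp)
  have w: "filterlim (\<lambda>N. sqrt (2 * ln (real N))) at_top sequentially" by real_asymp
  have "\<forall>\<^sub>F N in sequentially. y (sqrt (2 * ln (real N))) = x N"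
    using eventually_ln_pos by eventually_elim (simp add: x)
  from filterlim_cong[OF refl refl this] show "filterlim x at_top sequentially"
    using filterlim_compose[OF y w] by blast
  have "((\<lambda>w. exp (w\<^sup>2 / 2 - (y w)\<^sup>2 / 2 - ln w) / sqrt (2 * pi) * (w / y w))
      \<longlongrightarrow> exp (ln (2 * pi) / 2 - c) / sqrt (2 * pi) * 1) at_top"
    by (intro tendsto_intros sq ratio) auto
  also have "exp (ln (2 * pi) / 2 - c) / sqrt (2 * pi) * 1 = exp (- c)"
  proof -
    have "exp (ln (2 * pi) / 2) = sqrt (2 * pi)" by (simp add: ln_sqrt[symmetric])
    then show ?thesis unfolding diff_conv_add_uminus exp_add by simp
  qed
  finally have lim: "(\<lambda>N. exp ((sqrt (2 * ln (real N)))\<^sup>2 / 2 - (y (sqrt (2 * ln (real N))))\<^sup>2 / 2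
      - ln (sqrt (2 * ln (real N)))) / sqrt (2 * pi) * (sqrt (2 * ln (real N)) / y (sqrt (2 * ln (real N))))) \<longlonglongrightarrow> exp (- c)"
    by (rule filterlim_compose) (rule w)
  show "(\<lambda>N. real N * (std_normal_density (x N) / x N)) \<longlonglongrightarrow> exp (- c)"
  proof (rule Lim_transform_eventually[OF lim])
    show "\<forall>\<^sub>F N in sequentially. exp ((sqrt (2 * ln (real N)))\<^sup>2 / 2 - (y (sqrt (2 * ln (real N))))\<^sup>2 / 2
      - ln (sqrt (2 * ln (real N)))) / sqrt (2 * pi) * (sqrt (2 * ln (real N)) / y (sqrt (2 * ln (real N))))
      = real N * (std_normal_density (x N) / x N)"
      using eventually_ln_pos
    proof eventually_elim
      case (elim N)
      define v where "v = sqrt (2 * ln (real N))"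
      have v: "v > 0" "v\<^sup>2 / 2 = ln (real N)" using elim by (simp_all add: v_def)
      have "real N > 0" using elim by (cases "N = 0") auto
      then have "exp (v\<^sup>2 / 2 - q - ln v) = real N * exp (- q) / v" for q
        unfolding diff_conv_add_uminus exp_add v(2) using v(1) by (simp add: exp_minus divide_inverse)
      then show ?case using v(1) by (simp add: x[OF elim] v_def[symmetric] std_normal_density_def)
    qed
  qed
qed

text \<open>The correction in \<open>b\<close> absorbs the prefactor of the tail:
  \<open>b^2 / 2\<close> is \<open>w^2 / 2 - ln w - ln (2 * pi) / 2\<close> up to
  \<open>o(1)\<close>, and adding \<open>c / b\<close> raises half the square by \<open>c\<close> in
  the limit.\<close>

lemma gauss_tail_level:
  "(\<lambda>N. real N * gauss_tail (norm_b N + c / norm_b N)) \<longlonglongrightarrow> exp (- c)"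
proof -
  define K where "K = ln (2 * pi)"
  define b where "b w = w - (2 * ln w + K) / (2 * w)" for w
  show ?thesis
  proof (rule gauss_tail_limit; (fold K_def)?)
    show "((\<lambda>w. w\<^sup>2 / 2 - (b w + c / b w)\<^sup>2 / 2 - ln w) \<longlongrightarrow> K / 2 - c) at_top"
      unfolding b_def by real_asymp (simp add: field_simps)
    show "((\<lambda>w. w / (b w + c / b w)) \<longlongrightarrow> 1) at_top" "filterlim (\<lambda>w. b w + c / b w) at_top at_top"
      unfolding b_def by real_asymp+
  qed (simp add: b_def K_def norm_b_eq[OF _ refl])
qed

text \<open>The divisor is a lower bound for the relative standard deviation that is left after
  conditioning on far points. It changes the square of the level, of order \<open>ln N\<close>, only
  by a relative amount of order \<open>(ln N)^(-2)\<close>.\<close>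

lemma gauss_tail_perturbed_level:
  "(\<lambda>N. real N * gauss_tail ((norm_b N + c / norm_b N) / sqrt (1 - 1 / (ln (real N))\<^sup>2))) \<longlonglongrightarrow> exp (- c)"
proof -
  define K where "K = ln (2 * pi)"
  define b where "b w = w - (2 * ln w + K) / (2 * w)" for w
  show ?thesis
  proof (rule gauss_tail_limit; (fold K_def)?)
    show "((\<lambda>w. w\<^sup>2 / 2 - ((b w + c / b w) / sqrt (1 - 4 / w ^ 4))\<^sup>2 / 2 - ln w) \<longlongrightarrow> K / 2 - c) at_top"
      unfolding b_def by real_asymp (simp add: field_simps)
    show "((\<lambda>w. w / ((b w + c / b w) / sqrt (1 - 4 / w ^ 4))) \<longlongrightarrow> 1) at_top"
      "filterlim (\<lambda>w. (b w + c / b w) / sqrt (1 - 4 / w ^ 4)) at_top at_top"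
      unfolding b_def by real_asymp+
    fix N assume N: "0 < ln (real N)"
    then have "sqrt (2 * ln (real N)) ^ 4 = 4 * (ln (real N))\<^sup>2"
      using real_sqrt_pow2[of "2 * ln (real N)"] by (simp add: power4_eq_xxxx power2_eq_square)
    then show "(norm_b N + c / norm_b N) / sqrt (1 - 1 / (ln (real N))\<^sup>2)
      = (b (sqrt (2 * ln (real N))) + c / b (sqrt (2 * ln (real N)))) / sqrt (1 - 4 / sqrt (2 * ln (real N)) ^ 4)"
      by (simp add: b_def K_def norm_b_eq[OF N refl])
  qed
qed

text \<open>Multiplying the level by \<open>k\<close> costs an extra factor
  \<open>exp (- d * y^2)\<close>, a negative power of \<open>N\<close> up to lower-order factors. It
  outweighs the sixth power of the logarithm, the order of the number of near points.\<close>

lemma gauss_tail_pair_level: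
  assumes k: "k > 1"
  shows "(\<lambda>N. real N * (ln (real N))^6 * gauss_tail (k * (norm_b N + c / norm_b N))) \<longlonglongrightarrow> 0"
proof -
  define d where "d = (k\<^sup>2 - 1) / 2"
  have d: "d > 0" using k by (simp add: d_def power2_eq_square)
       (metis less_1_mult)
  define y where "y N = norm_b N + c / norm_b N" for N
  define r where "r N = (ln (real N))^6 * exp (- d * (y N)\<^sup>2) / k * (1 + 1 / (y N)\<^sup>2)" for N
  have "filterlim y at_top sequentially"
    unfolding y_def norm_b_def by real_asymp
  then have pos: "\<forall>\<^sub>F N in sequentially. 0 < y N"
    by (simp add: filterlim_at_top_dense)
  have "(\<lambda>N. (ln (real N))^6 * exp (- d * (y N)\<^sup>2)) \<longlonglongrightarrow> 0" "(\<lambda>N. 1 + 1 / (y N)\<^sup>2) \<longlonglongrightarrow> 1"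
    unfolding y_def norm_b_def using d by real_asymp+
  then have "r \<longlonglongrightarrow> 0 / k * 1"
    unfolding r_def by (intro tendsto_intros) (use k in auto)
  then have lim: "(\<lambda>N. r N * (real N * gauss_tail (y N))) \<longlonglongrightarrow> 0"
    using tendsto_mult[OF _ gauss_tail_level[of c, folded y_def], of r 0] by simp
  have "(\<lambda>N. real N * (ln (real N))^6 * gauss_tail (k * y N)) \<longlonglongrightarrow> 0"
  proof (rule tendsto_sandwich[OF _ _ tendsto_const lim])
    show "\<forall>\<^sub>F N in sequentially. real N * (ln (real N))^6 * gauss_tail (k * y N) \<le> r N * (real N * gauss_tail (y N))"
      using pos
    proof eventually_elim
      case (elim N)
      have "k * y N > 0" using elim k by simp
      have "- (k * y N)\<^sup>2 / 2 = - d * (y N)\<^sup>2 + - (y N)\<^sup>2 / 2"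
        by (simp add: d_def field_simps)
      then have eq: "std_normal_density (k * y N) / (k * y N) = exp (- d * (y N)\<^sup>2) / k * (std_normal_density (y N) / y N)"
        unfolding std_normal_density_def by (simp only: exp_add) simp
      have "gauss_tail (k * y N) \<le> exp (- d * (y N)\<^sup>2) / k * (std_normal_density (y N) / y N)"
        using gauss_tail_mills(1)[OF \<open>k * y N > 0\<close>] unfolding eq .
      also have "\<dots> \<le> exp (- d * (y N)\<^sup>2) / k * ((1 + 1 / (y N)\<^sup>2) * gauss_tail (y N))"
        using k by (intro mult_left_mono gauss_tail_mills(2)[OF elim]) auto
      finally have "real N * (ln (real N))^6 * gauss_tail (k * y N)
          \<le> real N * (ln (real N))^6 * (exp (- d * (y N)\<^sup>2) / k * ((1 + 1 / (y N)\<^sup>2) * gauss_tail (y N)))"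
        by (rule mult_left_mono) simp
      then show ?case by (simp add: r_def mult_ac)
    qed
  qed (auto simp: gauss_tail_nonneg)
  then show ?thesis by (simp add: y_def)
qed

section \<open>Gaussian fields\<close>

lemma std_normal_cis: "(LINT z|std_normal_distribution. cis (t * z)) = exp (- t\<^sup>2 / 2)"
  using char_std_normal_distribution by (simp add: char_def fun_eq_iff cis_conv_exp)

locale gaussian_field = prob_space M for M :: "'a measure" +
  fixes X :: "'i \<Rightarrow> 'a \<Rightarrow> real" and C :: "'i \<Rightarrow> 'i \<Rightarrow> real"
  assumes meas [measurable]: "\<And>a. X a \<in> borel_measurable M"
    and sym: "\<And>a b. C a b = C b a"
    and char_fun: "\<And>F c. finite F \<Longrightarrow> (LINT \<omega>|M. cis (\<Sum>a\<in>F. c a * X a \<omega>))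
        = complex_of_real (exp (- (\<Sum>a\<in>F. \<Sum>b\<in>F. c a * c b * C a b) / 2))"
begin

definition var :: "'i set \<Rightarrow> ('i \<Rightarrow> real) \<Rightarrow> real" where
  "var F c = (\<Sum>a\<in>F. \<Sum>b\<in>F. c a * c b * C a b)"

lemma char_var: "finite F \<Longrightarrow> (LINT \<omega>|M. cis (\<Sum>a\<in>F. c a * X a \<omega>)) = complex_of_real (exp (- var F c / 2))"
  unfolding var_def by (rule char_fun)

text \<open>A characteristic function has modulus at most 1, so positive semidefiniteness of
  \<open>C\<close> comes from the existence of the field.\<close>

lemma var_nonneg:
  assumes "finite F" shows "0 \<le> var F c"
proof -
  have "norm (LINT \<omega>|M. cis (\<Sum>a\<in>F. c a * X a \<omega>)) \<le> (LINT \<omega>|M. norm (cis (\<Sum>a\<in>F. c a * X a \<omega>)))"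
    by (rule integral_norm_bound)
  also have "\<dots> = 1" by (simp add: prob_space)
  finally show ?thesis unfolding char_var[OF assms] by simp
qed

lemma var_scale: "var F (\<lambda>a. t * c a) = t\<^sup>2 * var F c"
  unfolding var_def by (simp add: sum_distrib_left power2_eq_square mult_ac)

text \<open>Comparison with a scaled normal, instead of division by the standard deviation, also
  covers variance 0.\<close>

lemma linear_combination_law:
  assumes F: "finite F"
  shows "prob {\<omega>\<in>space M. u \<le> (\<Sum>a\<in>F. c a * X a \<omega>)} = measure std_normal_distribution {z. u \<le> sqrt (var F c) * z}"
proof -
  have "prob {\<omega>\<in>space M. \<forall>i\<in>{()}. (\<Sum>a\<in>F. c a * X a \<omega>) \<in> {u..}}
      = measure std_normal_distribution {z\<in>space std_normal_distribution. \<forall>i\<in>{()}. sqrt (var F c) * z \<in> {u..}}"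
  proof (rule joint_char_unique[where X = "\<lambda>_ \<omega>. \<Sum>a\<in>F. c a * X a \<omega>" and Y = "\<lambda>_ z. sqrt (var F c) * z" and B = "\<lambda>_. {u..}"])
    fix t :: "unit \<Rightarrow> real"
    have "(LINT \<omega>|M. cis (t () * (\<Sum>a\<in>F. c a * X a \<omega>))) = complex_of_real (exp (- ((t ())\<^sup>2 * var F c) / 2))"
      using char_var[OF F, of "\<lambda>a. t () * c a"] by (simp only: var_scale sum_distrib_left mult.assoc)
    also have "\<dots> = (LINT z|std_normal_distribution. cis (t () * (sqrt (var F c) * z)))"
      using std_normal_cis[of "t () * sqrt (var F c)"] var_nonneg[OF F] by (simp add: power_mult_distrib mult.assoc)
    finally show "(LINT \<omega>|M. cis (\<Sum>i\<in>{()}. t i * (\<Sum>a\<in>F. c a * X a \<omega>)))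
        = (LINT z|std_normal_distribution. cis (\<Sum>i\<in>{()}. t i * (sqrt (var F c) * z)))" by simp
  qed (auto intro: prob_space_axioms std_normal_prob_space)
  then show ?thesis by simp
qed

lemma linear_combination_tail:
  assumes F: "finite F" and v: "var F c > 0"
  shows "prob {\<omega>\<in>space M. u \<le> (\<Sum>a\<in>F. c a * X a \<omega>)} = gauss_tail (u / sqrt (var F c))"
proof -
  have "{z. u \<le> sqrt (var F c) * z} = {u / sqrt (var F c)..}"
    using v by (auto simp: field_simps)
  then show ?thesis by (simp add: linear_combination_law[OF F] gauss_tail_def)
qed

text \<open>This crude bound serves for the conditional mean, where \<open>sqrt s\<close> is of
  smaller order than \<open>u\<close>. Variance 0 is included; it occurs for empty
  \<open>F\<close>.\<close>

lemma linear_combination_tail_le: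
  assumes F: "finite F" and v: "var F c \<le> s" and u: "u > 0"
  shows "prob {\<omega>\<in>space M. u \<le> (\<Sum>a\<in>F. c a * X a \<omega>)} \<le> sqrt s / u"
proof (cases "var F c = 0")
  case True
  then show ?thesis using u v by (simp add: linear_combination_law[OF F])
next
  case False
  with var_nonneg[OF F, of c] have v0: "var F c > 0" by simp
  have "gauss_tail (u / sqrt (var F c)) \<le> 1 / (u / sqrt (var F c))"
  proof (rule order_trans[OF gauss_tail_mills(1)])
    have "1 \<le> sqrt (2 * pi)" using pi_ge_two by simp
    then have "std_normal_density t \<le> 1" for t
      by (simp add: std_normal_density_def divide_le_eq_1 order_trans[of _ 1])
    then show "std_normal_density (u / sqrt (var F c)) / (u / sqrt (var F c)) \<le> 1 / (u / sqrt (var F c))"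
      using u v0 by (intro divide_right_mono) auto
  qed (use u v0 in simp)
  also have "\<dots> \<le> sqrt s / u" using u v by (simp add: divide_right_mono)
  finally show ?thesis using linear_combination_tail[OF F v0] by simp
qed

lemma single_tail:
  assumes "C a a > 0"
  shows "prob {\<omega>\<in>space M. u \<le> X a \<omega>} = gauss_tail (u / sqrt (C a a))"
  using linear_combination_tail[of "{a}" "\<lambda>_. 1" u] assms by (simp add: var_def)

text \<open>A joint exceedance forces the sum, which is again Gaussian, above
  \<open>2 * u\<close>.\<close>

lemma pair_tail_le:
  assumes ab: "a \<noteq> b" and v: "C a a + C b b + 2 * C a b > 0"
  shows "prob {\<omega>\<in>space M. u \<le> X a \<omega> \<and> u \<le> X b \<omega>} \<le> gauss_tail (2 * u / sqrt (C a a + C b b + 2 * C a b))"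
proof -
  have var: "var {a, b} (\<lambda>_. 1) = C a a + C b b + 2 * C a b"
    using ab sym[of a b] by (simp add: var_def)
  have "prob {\<omega>\<in>space M. u \<le> X a \<omega> \<and> u \<le> X b \<omega>} \<le> prob {\<omega>\<in>space M. 2 * u \<le> (\<Sum>i\<in>{a, b}. 1 * X i \<omega>)}"
    by (rule finite_measure_mono) (use ab in auto)
  also have "\<dots> = gauss_tail (2 * u / sqrt (C a a + C b b + 2 * C a b))"
    using linear_combination_tail[of "{a, b}" "\<lambda>_. 1" "2 * u"] v unfolding var by simp
  finally show ?thesis .
qed

text \<open>If the covariances between \<open>X a\<close> and \<open>F\<close> are those of the combination \<open>Y\<close> with weights
  \<open>h\<close>, then jointly with \<open>F\<close> the variable \<open>X a\<close> has the law of \<open>Y + \<sigma> Z\<close> with an independent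
  standard normal \<open>Z\<close>.\<close>

lemma prob_decouple:
  assumes F: "finite F" and a: "a \<notin> F"
    and h: "\<And>x. x \<in> F \<Longrightarrow> C a x = (\<Sum>c\<in>F. h c * C c x)"
    and v: "v = (\<Sum>c\<in>F. h c * C a c)" and s: "s\<^sup>2 = C a a - v" "s > 0"
    and B [measurable]: "\<And>i. B i \<in> sets borel"
  defines "E \<equiv> {\<omega>\<in>space M. \<forall>i\<in>F. X i \<omega> \<in> B i}"
  shows "prob {\<omega>\<in>space M. u \<le> X a \<omega> \<and> \<omega> \<in> E}
    = (LINT \<omega>|M. indicator E \<omega> * gauss_tail ((u - (\<Sum>c\<in>F. h c * X c \<omega>)) / s))"
proof -
  define Q where "Q = M \<Otimes>\<^sub>M std_normal_distribution"
  interpret N: prob_space std_normal_distribution by (rule std_normal_prob_space)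
  interpret MN: pair_prob_space M std_normal_distribution ..
  interpret Q: prob_space Q unfolding Q_def by (intro prob_space_pair prob_space_axioms N.prob_space_axioms)
  define Y where "Y i w = (if i = a then (\<Sum>c\<in>F. h c * X c (fst w)) + s * snd w else X i (fst w))" for i and w :: "'a \<times> real"
  have Ym [measurable]: "Y i \<in> borel_measurable Q" for i
    unfolding Y_def Q_def by measurable
  define B' where "B' i = (if i = a then {u..} else B i)" for i
  have cisM [measurable]: "cis \<in> borel_measurable borel"
    by (intro borel_measurable_continuous_onI continuous_intros)
  have "prob {\<omega>\<in>space M. \<forall>i\<in>insert a F. X i \<omega> \<in> B' i} = measure Q {w\<in>space Q. \<forall>i\<in>insert a F. Y i w \<in> B' i}"
  proof (rule joint_char_unique)
    show "prob_space M" "prob_space Q" by (rule prob_space_axioms, rule Q.prob_space_axioms)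
    show "finite (insert a F)" using F by simp
    fix t :: "'i \<Rightarrow> real"
    have var1: "var (insert a F) t = (t a)\<^sup>2 * C a a + 2 * t a * (\<Sum>b\<in>F. t b * C a b) + var F t"
    proof -
      have "(\<Sum>i\<in>F. t i * t a * C i a) = t a * (\<Sum>b\<in>F. t b * C a b)"
        unfolding sum_distrib_left
      proof (rule sum.cong[OF refl])
        fix i show "t i * t a * C i a = t a * (t i * C a i)" using sym[of i a] by simp
      qed
      moreover have "(\<Sum>b\<in>F. t a * t b * C a b) = t a * (\<Sum>b\<in>F. t b * C a b)"
        by (simp add: sum_distrib_left mult.assoc)
      ultimately show ?thesis
        unfolding var_def sum.insert[OF F a] sum.distrib by (simp add: power2_eq_square)
    qed
    have h': "(\<Sum>b\<in>F. h b * C i b) = C a i" if "i \<in> F" for i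
      unfolding h[OF that] by (intro sum.cong refl) (metis sym)
    have cross: "(\<Sum>i\<in>F. \<Sum>b\<in>F. t i * h b * C i b) = (\<Sum>b\<in>F. t b * C a b)"
      by (rule sum.cong[OF refl]) (simp add: h'[symmetric] sum_distrib_left mult_ac)
    have hh: "(\<Sum>i\<in>F. \<Sum>b\<in>F. h i * h b * C i b) = v"
    proof -
      have "(\<Sum>i\<in>F. \<Sum>b\<in>F. h i * h b * C i b) = (\<Sum>i\<in>F. h i * (\<Sum>b\<in>F. h b * C i b))"
        by (simp add: sum_distrib_left mult_ac)
      also have "\<dots> = v" unfolding v by (intro sum.cong refl) (simp add: h')
      finally show ?thesis .
    qed
    \<comment> \<open>The two variances match: \<open>h\<close> reproduces the cross terms
      (\<open>cross\<close>), the combination itself has variance \<open>v\<close>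
      (\<open>hh\<close>), and the independent normal adds the missing
      \<open>s^2 = C a a - v\<close>.\<close>
    have var2: "var F (\<lambda>i. t i + t a * h i) = var F t + 2 * t a * (\<Sum>b\<in>F. t b * C a b) + (t a)\<^sup>2 * v"
    proof -
      have "var F (\<lambda>i. t i + t a * h i) = var F t + t a * (\<Sum>i\<in>F. \<Sum>b\<in>F. t i * h b * C i b)
          + t a * (\<Sum>i\<in>F. \<Sum>b\<in>F. h i * t b * C i b) + (t a)\<^sup>2 * (\<Sum>i\<in>F. \<Sum>b\<in>F. h i * h b * C i b)"
        unfolding var_def sum_distrib_left sum.distrib[symmetric]
        by (intro sum.cong refl) (simp add: power2_eq_square algebra_simps)
      moreover have "(\<Sum>i\<in>F. \<Sum>b\<in>F. h i * t b * C i b) = (\<Sum>i\<in>F. \<Sum>b\<in>F. t i * h b * C i b)"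
        by (subst sum.swap) (simp add: sym mult_ac)
      ultimately show ?thesis unfolding cross hh by simp
    qed
    have lin: "(\<Sum>i\<in>insert a F. t i * Y i (\<omega>, z)) = (\<Sum>i\<in>F. (t i + t a * h i) * X i \<omega>) + (t a * s) * z" for \<omega> z
    proof -
      have "(\<Sum>i\<in>F. t i * Y i (\<omega>, z)) = (\<Sum>i\<in>F. t i * X i \<omega>)"
        using a by (intro sum.cong) (auto simp: Y_def)
      then show ?thesis
        unfolding sum.insert[OF F a] by (simp add: Y_def sum.distrib sum_distrib_left distrib_left distrib_right mult_ac)
    qed
    have "(LINT w|Q. cis (\<Sum>i\<in>insert a F. t i * Y i w))
        = (LINT \<omega>|M. LINT z|std_normal_distribution. cis (\<Sum>i\<in>insert a F. t i * Y i (\<omega>, z)))"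
      unfolding Q_def
    proof (rule MN.integral_fst'[symmetric])
      show "integrable (M \<Otimes>\<^sub>M std_normal_distribution) (\<lambda>w. cis (\<Sum>i\<in>insert a F. t i * Y i w))"
        unfolding Q_def[symmetric]
        by (rule Q.integrable_const_bound[where B = 1]) auto
    qed
    also have "\<dots> = (LINT \<omega>|M. cis (\<Sum>i\<in>F. (t i + t a * h i) * X i \<omega>) * complex_of_real (exp (- (t a * s)\<^sup>2 / 2)))"
      unfolding lin cis_mult[symmetric] by (simp add: std_normal_cis)
    also have "\<dots> = complex_of_real (exp (- var F (\<lambda>i. t i + t a * h i) / 2)) * complex_of_real (exp (- (t a * s)\<^sup>2 / 2))"
      by (simp add: char_var[OF F])
    also have "\<dots> = complex_of_real (exp (- var (insert a F) t / 2))"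
      unfolding of_real_mult[symmetric] exp_add[symmetric] var1 var2
      by (simp add: power_mult_distrib s field_simps)
    also have "\<dots> = (LINT \<omega>|M. cis (\<Sum>i\<in>insert a F. t i * X i \<omega>))"
      using F by (simp only: char_var finite_insert)
    finally show "(LINT \<omega>|M. cis (\<Sum>i\<in>insert a F. t i * X i \<omega>)) = (LINT w|Q. cis (\<Sum>i\<in>insert a F. t i * Y i w))" ..
  qed (auto simp: B'_def)
  also have "{\<omega>\<in>space M. \<forall>i\<in>insert a F. X i \<omega> \<in> B' i} = {\<omega>\<in>space M. u \<le> X a \<omega> \<and> \<omega> \<in> E}"
    using a by (auto simp: B'_def E_def)
  also have "measure Q {w\<in>space Q. \<forall>i\<in>insert a F. Y i w \<in> B' i}
     = (LINT w|Q. indicator {w\<in>space Q. \<forall>i\<in>insert a F. Y i w \<in> B' i} w)"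
    by (simp add: Int_absorb2)
  \<comment> \<open>By Fubini, \<open>z\<close> is integrated out first: for fixed
    \<open>\<omega>\<close> the condition at \<open>a\<close> is a half-line for \<open>z\<close>,
    and the conditions on \<open>F\<close> do not involve \<open>z\<close>.\<close>
  also have "\<dots> = (LINT \<omega>|M. LINT z|std_normal_distribution. indicator {w\<in>space Q. \<forall>i\<in>insert a F. Y i w \<in> B' i} (\<omega>, z))"
    unfolding Q_def
  proof (rule MN.integral_fst'[symmetric])
    have [measurable]: "B' i \<in> sets borel" for i by (simp add: B'_def)
    have "{w\<in>space Q. \<forall>i\<in>insert a F. Y i w \<in> B' i} \<in> sets Q"
    proof (rule sets.sets_Collect_finite_All)
      show "{w\<in>space Q. Y i w \<in> B' i} \<in> sets Q" for i by measurable
    qed (use F in simp)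
    then have "integrable Q (indicat_real {w\<in>space Q. \<forall>i\<in>insert a F. Y i w \<in> B' i})"
      by (intro integrable_real_indicator) (auto simp: less_top[symmetric])
    then show "integrable (M \<Otimes>\<^sub>M std_normal_distribution)
        (indicat_real {w\<in>space (M \<Otimes>\<^sub>M std_normal_distribution). \<forall>i\<in>insert a F. Y i w \<in> B' i})"
      by (simp only: Q_def)
  qed
  also have "\<dots> = (LINT \<omega>|M. indicator E \<omega> * gauss_tail ((u - (\<Sum>c\<in>F. h c * X c \<omega>)) / s))"
  proof (rule Bochner_Integration.integral_cong[OF refl])
    fix \<omega> assume \<omega>: "\<omega> \<in> space M"
    have "indicator {w\<in>space Q. \<forall>i\<in>insert a F. Y i w \<in> B' i} (\<omega>, z)
        = indicat_real E \<omega> * indicat_real {(u - (\<Sum>c\<in>F. h c * X c \<omega>)) / s..} z" for z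
      using \<omega> a s by (auto simp: indicator_def E_def B'_def Y_def Q_def space_pair_measure field_simps)
    then show "(LINT z|std_normal_distribution. indicator {w\<in>space Q. \<forall>i\<in>insert a F. Y i w \<in> B' i} (\<omega>, z))
      = indicator E \<omega> * gauss_tail ((u - (\<Sum>c\<in>F. h c * X c \<omega>)) / s)"
      by (simp add: gauss_tail_def)
  qed
  finally show ?thesis .
qed

text \<open>\<open>H\<close> is the conditional probability of an exceedance at \<open>a\<close>
  given \<open>F\<close>, and its mean is \<open>p\<close>. Hence its excess over \<open>p\<close>
  and its deficit have the same mean \<open>D\<close>, which bounds the error on any event
  determined by \<open>F\<close>. The deficit calls only for a lower bound on \<open>H\<close>,
  available wherever the conditional mean \<open>Y\<close> exceeds \<open>- \<eta>\<close>.\<close>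

lemma far_decorrelation:
  fixes u G s \<eta> :: real
  assumes F: "finite F" and a: "a \<notin> F"
    and h0: "\<And>c. 0 \<le> h c" and h1: "(\<Sum>c\<in>F. h c) \<le> 1"
    and h: "\<And>x. x \<in> F \<Longrightarrow> C a x = (\<Sum>c\<in>F. h c * C c x)"
    and far: "\<And>x. x \<in> F \<Longrightarrow> C a x \<le> s"
    and G: "C a a = G" "0 \<le> s" "s < G" and u: "0 \<le> u" and \<eta>: "0 < \<eta>"
  defines "p \<equiv> gauss_tail (u / sqrt G)"
  shows "\<bar>prob {\<omega>\<in>space M. u \<le> X a \<omega> \<and> (\<forall>i\<in>F. X i \<omega> < u)} - p * prob {\<omega>\<in>space M. \<forall>i\<in>F. X i \<omega> < u}\<bar>
    \<le> \<bar>p - gauss_tail ((u + \<eta>) / sqrt (G - s))\<bar> + p * (sqrt s / \<eta>)"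
proof -
  define v where "v = (\<Sum>c\<in>F. h c * C a c)"
  define Y where "Y \<omega> = (\<Sum>c\<in>F. h c * X c \<omega>)" for \<omega>
  define \<sigma> where "\<sigma> = sqrt (G - v)"
  define H where "H \<omega> = gauss_tail ((u - Y \<omega>) / \<sigma>)" for \<omega>
  define \<tau> where "\<tau> = gauss_tail ((u + \<eta>) / sqrt (G - s))"
  define E where "E = {\<omega>\<in>space M. \<forall>i\<in>F. X i \<omega> \<in> {..<u}}"
  have [measurable]: "Y \<in> borel_measurable M" unfolding Y_def by measurable
  have [measurable]: "H \<in> borel_measurable M" unfolding H_def by measurable
  have [measurable]: "E \<in> sets M" unfolding E_def using F by measurable
  have E': "E = {\<omega>\<in>space M. \<forall>i\<in>F. X i \<omega> < u}" by (auto simp: E_def)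
  have H: "0 \<le> H \<omega>" "H \<omega> \<le> 1" for \<omega> by (simp_all add: H_def gauss_tail_nonneg gauss_tail_le_1)
  have p: "0 \<le> p" "p \<le> 1" by (simp_all add: p_def gauss_tail_nonneg gauss_tail_le_1)
  \<comment> \<open>Nonnegativity of the weights enters here: \<open>v\<close> is a weighted sum, of
    total weight at most 1, of covariances with far points.\<close>
  have "v \<le> (\<Sum>c\<in>F. h c * s)"
    unfolding v_def using far h0 by (intro sum_mono mult_left_mono) auto
  also have "\<dots> \<le> s" unfolding sum_distrib_right[symmetric] using h1 G mult_right_mono[of _ 1 s] by fastforce
  finally have vs: "v \<le> s" .
  then have \<sigma>: "\<sigma>\<^sup>2 = C a a - v" "\<sigma> > 0" "sqrt (G - s) \<le> \<sigma>" using G by (simp_all add: \<sigma>_def)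
  have var: "var F h = v"
  proof -
    have "(\<Sum>i\<in>F. h i * h b * C i b) = h b * (\<Sum>i\<in>F. h i * C i b)" for b
      by (simp add: sum_distrib_left mult_ac)
    then show ?thesis
      unfolding var_def v_def by (subst sum.swap) (simp add: h[symmetric])
  qed
  have dec: "prob {\<omega>\<in>space M. u \<le> X a \<omega> \<and> (\<forall>i\<in>F. X i \<omega> \<in> B)}
      = (LINT \<omega>|M. indicator {\<omega>\<in>space M. \<forall>i\<in>F. X i \<omega> \<in> B} \<omega> * H \<omega>)" if "B \<in> sets borel" for B
  proof -
    have "{\<omega>\<in>space M. u \<le> X a \<omega> \<and> (\<forall>i\<in>F. X i \<omega> \<in> B)}
        = {\<omega>\<in>space M. u \<le> X a \<omega> \<and> \<omega> \<in> {\<omega>\<in>space M. \<forall>i\<in>F. X i \<omega> \<in> B}}" by auto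
    then show ?thesis
      using prob_decouple[OF F a h v_def \<sigma>(1,2), of "\<lambda>_. B" u] that by (simp only: H_def Y_def)
  qed
  have p_eq: "p = prob {\<omega>\<in>space M. u \<le> X a \<omega>}"
    using single_tail[of a u] G by (simp add: p_def)
  \<comment> \<open>The choice \<open>B = UNIV\<close> removes the condition on
    \<open>F\<close>.\<close>
  have EH: "(LINT \<omega>|M. H \<omega>) = p"
    using dec[of UNIV] unfolding p_eq by (simp cong: Bochner_Integration.integral_cong)
  have intH: "integrable M H" by (rule integrable_const_bound[of _ 1]) (use H in auto)
  have intE: "integrable M (\<lambda>\<omega>. indicator E \<omega> * H \<omega>)"
    by (rule integrable_const_bound[of _ 1]) (use H in \<open>auto simp: indicator_def\<close>)
  have intEH: "integrable M (\<lambda>\<omega>. indicator E \<omega> * H \<omega> - p * indicator E \<omega>)"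
    using intE by (intro Bochner_Integration.integrable_diff integrable_mult_right) (auto simp: less_top[symmetric])
  define D where "D = (LINT \<omega>|M. max 0 (p - H \<omega>))"
  have intD: "integrable M (\<lambda>\<omega>. max 0 (p - H \<omega>))"
  proof (rule integrable_const_bound[of _ 1])
    have "norm (max 0 (p - H \<omega>)) \<le> 1" for \<omega> using H[of \<omega>] p by simp
    then show "AE \<omega> in M. norm (max 0 (p - H \<omega>)) \<le> 1" by blast
  qed measurable
  have diff: "prob {\<omega>\<in>space M. u \<le> X a \<omega> \<and> (\<forall>i\<in>F. X i \<omega> < u)} - p * prob {\<omega>\<in>space M. \<forall>i\<in>F. X i \<omega> < u}
    = (LINT \<omega>|M. indicator E \<omega> * H \<omega> - p * indicator E \<omega>)"
  proof -
    have "prob {\<omega>\<in>space M. \<forall>i\<in>F. X i \<omega> < u} = (LINT \<omega>|M. indicator E \<omega>)"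
      by (simp add: E'[symmetric] Int_absorb2)
    then show ?thesis using dec[of "{..<u}"] intE
      by (subst Bochner_Integration.integral_diff) (auto simp: E'[symmetric] less_top[symmetric])
  qed
  have up: "(LINT \<omega>|M. indicator E \<omega> * H \<omega> - p * indicator E \<omega>) \<le> D"
  proof -
    have "(LINT \<omega>|M. indicator E \<omega> * H \<omega> - p * indicator E \<omega>) \<le> (LINT \<omega>|M. max 0 (p - H \<omega>) + (H \<omega> - p))"
    proof (rule integral_mono[OF intEH])
      show "indicator E \<omega> * H \<omega> - p * indicator E \<omega> \<le> max 0 (p - H \<omega>) + (H \<omega> - p)" for \<omega>
        by (cases "\<omega> \<in> E") (simp_all add: max_def)
    qed (use intD intH in simp)
    also have "\<dots> = D" using intD intH EH by (simp add: D_def prob_space)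
    finally show ?thesis .
  qed
  have low: "- D \<le> (LINT \<omega>|M. indicator E \<omega> * H \<omega> - p * indicator E \<omega>)"
  proof -
    have "(LINT \<omega>|M. - max 0 (p - H \<omega>)) \<le> (LINT \<omega>|M. indicator E \<omega> * H \<omega> - p * indicator E \<omega>)"
    proof (rule integral_mono[OF _ intEH])
      show "- max 0 (p - H \<omega>) \<le> indicator E \<omega> * H \<omega> - p * indicator E \<omega>" for \<omega>
        by (cases "\<omega> \<in> E") (simp_all add: max_def)
    qed (use intD in simp)
    then show ?thesis using intD by (simp add: D_def)
  qed
  have "D \<le> (LINT \<omega>|M. \<bar>p - \<tau>\<bar> + p * indicator {\<omega>\<in>space M. \<eta> \<le> - Y \<omega>} \<omega>)"
    unfolding D_def
  proof (rule integral_mono[OF intD])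
    show "integrable M (\<lambda>\<omega>. \<bar>p - \<tau>\<bar> + p * indicator {\<omega>\<in>space M. \<eta> \<le> - Y \<omega>} \<omega>)"
      by (auto simp: less_top[symmetric])
    fix \<omega> assume \<omega>: "\<omega> \<in> space M"
    show "max 0 (p - H \<omega>) \<le> \<bar>p - \<tau>\<bar> + p * indicator {\<omega>\<in>space M. \<eta> \<le> - Y \<omega>} \<omega>"
    \<comment> \<open>A very negative \<open>Y\<close> is rare and costs at most \<open>p\<close>.
      Otherwise the shifted level \<open>u + \<eta>\<close>, with the smallest admissible standard
      deviation \<open>sqrt (G - s)\<close>, bounds \<open>H\<close> from below.\<close>
    proof (cases "\<eta> \<le> - Y \<omega>")
      case True
      then show ?thesis using \<omega> H[of \<omega>] p by simp
    next
      case False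
      have "(u - Y \<omega>) / \<sigma> \<le> (u + \<eta>) / \<sigma>" using False \<sigma> by (intro divide_right_mono) auto
      also have "\<dots> \<le> (u + \<eta>) / sqrt (G - s)" using \<sigma> u \<eta> G by (intro divide_left_mono) auto
      finally have "\<tau> \<le> H \<omega>" unfolding \<tau>_def H_def by (rule gauss_tail_antimono)
      then show ?thesis using False by simp
    qed
  qed
  also have "\<dots> = \<bar>p - \<tau>\<bar> + p * prob {\<omega>\<in>space M. \<eta> \<le> - Y \<omega>}"
    by (simp add: prob_space Int_absorb2 less_top[symmetric])
  also have "\<dots> \<le> \<bar>p - \<tau>\<bar> + p * (sqrt s / \<eta>)"
  proof -
    have "var F (\<lambda>c. - h c) = v" using var_scale[of F "-1" h] var by simp
    then have "prob {\<omega>\<in>space M. \<eta> \<le> (\<Sum>c\<in>F. - h c * X c \<omega>)} \<le> sqrt s / \<eta>"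
      using vs \<eta> by (intro linear_combination_tail_le F) simp
    then show ?thesis using p by (intro add_mono mult_left_mono) (simp_all add: Y_def sum_negf)
  qed
  finally have "D \<le> \<bar>p - \<tau>\<bar> + p * (sqrt s / \<eta>)" .
  then show ?thesis using up low unfolding diff \<tau>_def by linarith
qed

text \<open>In \<open>err\<close>, \<open>n * \<tau>\<close> pays for joint exceedances at
  \<open>a\<close> and a near point, \<open>n * p^2\<close> for restoring the near points in
  \<open>p * prob (W D)\<close>, and the rest is the far error. Errors of earlier points are
  multiplied by \<open>1 - p\<close>, at most 1, at each later point, so they merely add up.\<close>

lemma void_probability:
  fixes u G s \<eta> n \<tau> :: real
  assumes A: "finite A"
    and balayage: "\<And>F a. finite F \<Longrightarrow> a \<notin> F \<Longrightarrow> \<exists>h. (\<forall>c. 0 \<le> h c) \<and> (\<Sum>c\<in>F. h c) \<le> 1 \<and>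
      (\<forall>x\<in>F. C a x = (\<Sum>c\<in>F. h c * C c x))"
    and near: "\<And>a. finite {b. s \<le> C a b}" "\<And>a. real (card {b. s \<le> C a b}) \<le> n"
    and pair: "\<And>a b. a \<noteq> b \<Longrightarrow> prob {\<omega>\<in>space M. u \<le> X a \<omega> \<and> u \<le> X b \<omega>} \<le> \<tau>"
    and \<tau>: "0 \<le> \<tau>" and G: "\<And>a. C a a = G" "0 \<le> s" "s < G" and u: "0 \<le> u" and \<eta>: "0 < \<eta>"
  defines "p \<equiv> gauss_tail (u / sqrt G)"
  defines "err \<equiv> n * \<tau> + n * p\<^sup>2 + (\<bar>p - gauss_tail ((u + \<eta>) / sqrt (G - s))\<bar> + p * (sqrt s / \<eta>))"
  shows "\<bar>prob {\<omega>\<in>space M. \<forall>i\<in>A. X i \<omega> < u} - (1 - p) ^ card A\<bar> \<le> real (card A) * err"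
proof -
  define W where "W F = {\<omega>\<in>space M. \<forall>i\<in>F. X i \<omega> < u}" for F
  have W [measurable]: "W F \<in> sets M" if "finite F" for F unfolding W_def using that by measurable
  have p: "0 \<le> p" "p \<le> 1" by (simp_all add: p_def gauss_tail_nonneg gauss_tail_le_1)
  have p_eq: "prob {\<omega>\<in>space M. u \<le> X a \<omega>} = p" for a
    using single_tail[of a u] G by (simp add: p_def)
  have step: "\<bar>prob ({\<omega>\<in>space M. u \<le> X a \<omega>} \<inter> W D) - p * prob (W D)\<bar> \<le> err"
    if D: "finite D" and a: "a \<notin> D" for a D
  proof -
    define N F where "N = {b\<in>D. s \<le> C a b}" and "F = {b\<in>D. C a b < s}"
    have fin: "finite N" "finite F" using D by (auto simp: N_def F_def)
    have DNF: "D = N \<union> F" by (auto simp: N_def F_def)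
    have "real (card N) \<le> real (card {b. s \<le> C a b})"
      using near(1)[of a] by (intro of_nat_mono card_mono) (auto simp: N_def)
    then have cN: "real (card N) \<le> n" using near(2)[of a] by simp
    define U where "U b = {\<omega>\<in>space M. u \<le> X b \<omega>}" for b
    have [measurable]: "U b \<in> sets M" for b unfolding U_def by measurable
    \<comment> \<open>Used with \<open>S = U a\<close> and with \<open>S\<close> the whole space:
      leaving out the near points changes the probability by at most that of an exceedance at one of
      them.\<close>
    have lose: "\<bar>prob (S \<inter> W D) - prob (S \<inter> W F)\<bar> \<le> real (card N) * q"
      if S [measurable]: "S \<in> sets M" and q: "\<And>b. b \<in> N \<Longrightarrow> prob (S \<inter> U b) \<le> q" for S q
    proof -
      have sub: "S \<inter> W D \<subseteq> S \<inter> W F" by (auto simp: W_def DNF)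
      have "prob (S \<inter> W F) - prob (S \<inter> W D) = prob ((S \<inter> W F) - (S \<inter> W D))"
        using W[OF fin(2)] W[OF D] sub by (intro finite_measure_Diff[symmetric]) auto
      also have "\<dots> \<le> prob (\<Union>b\<in>N. S \<inter> U b)"
      proof (rule finite_measure_mono)
        show "(S \<inter> W F) - (S \<inter> W D) \<subseteq> (\<Union>b\<in>N. S \<inter> U b)"
          by (auto simp: W_def U_def DNF not_less)
        show "(\<Union>b\<in>N. S \<inter> U b) \<in> events"
          using fin by (intro sets.finite_UN) auto
      qed
      also have "\<dots> \<le> (\<Sum>b\<in>N. prob (S \<inter> U b))"
        by (rule finite_measure_subadditive_finite) (use fin in auto)
      also have "\<dots> \<le> real (card N) * q" by (rule sum_bounded_above) (rule q)
      finally show ?thesis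
        using finite_measure_mono[OF sub] W[OF fin(2)] by auto
    qed
    have "\<bar>prob (U a \<inter> W D) - prob (U a \<inter> W F)\<bar> \<le> real (card N) * \<tau>"
    proof (rule lose)
      fix b assume "b \<in> N"
      then have "a \<noteq> b" using a by (auto simp: N_def)
      then show "prob (U a \<inter> U b) \<le> \<tau>"
        using pair[of a b] by (simp add: U_def Int_def conj_ac)
    qed simp
    moreover have "real (card N) * \<tau> \<le> n * \<tau>"
      using cN \<tau> by (rule mult_right_mono)
    moreover have "\<bar>p * prob (W D) - p * prob (W F)\<bar> \<le> n * p\<^sup>2"
    proof -
      have "\<bar>prob (space M \<inter> W D) - prob (space M \<inter> W F)\<bar> \<le> real (card N) * p"
        by (rule lose) (auto simp: U_def p_eq Int_def)
      then have "\<bar>prob (W D) - prob (W F)\<bar> \<le> real (card N) * p"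
        by (simp add: Int_absorb2[of "W _"] W_def Int_def)
      also have "\<dots> \<le> n * p" using cN p by (intro mult_right_mono)
      finally have "p * \<bar>prob (W D) - prob (W F)\<bar> \<le> p * (n * p)"
        using p by (intro mult_left_mono)
      then show ?thesis using p by (simp add: abs_mult power2_eq_square mult_ac flip: right_diff_distrib)
    qed
    moreover have "\<bar>prob (U a \<inter> W F) - p * prob (W F)\<bar> \<le> \<bar>p - gauss_tail ((u + \<eta>) / sqrt (G - s))\<bar> + p * (sqrt s / \<eta>)"
    proof -
      have aF: "a \<notin> F" using a by (auto simp: F_def)
      obtain h where h: "\<forall>c. 0 \<le> h c" "(\<Sum>c\<in>F. h c) \<le> 1" "\<forall>x\<in>F. C a x = (\<Sum>c\<in>F. h c * C c x)"
        using balayage[OF fin(2) aF] by blast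
      have eq: "U a \<inter> W F = {\<omega>\<in>space M. u \<le> X a \<omega> \<and> (\<forall>i\<in>F. X i \<omega> < u)}" by (auto simp: U_def W_def)
      show ?thesis
        unfolding eq unfolding W_def p_def
      proof (rule far_decorrelation[OF fin(2) aF])
        show "0 \<le> h c" "(\<Sum>c\<in>F. h c) \<le> 1" for c using h by auto
        show "C a x = (\<Sum>c\<in>F. h c * C c x)" "C a x \<le> s" if "x \<in> F" for x
          using h(3) that by (auto simp: F_def)
      qed (use G u \<eta> in auto)
    qed
    ultimately show ?thesis unfolding err_def U_def by linarith
  qed
  have "\<bar>prob (W A) - (1 - p) ^ card A\<bar> \<le> real (card A) * err"
    using A
  proof (induction A rule: finite_induct)
    case empty
    then show ?case by (simp add: W_def prob_space)
  next
    case (insert a D)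
    have "W (insert a D) = W D - {\<omega>\<in>space M. u \<le> X a \<omega>} \<inter> W D" by (auto simp: W_def)
    then have "prob (W (insert a D)) = prob (W D) - prob ({\<omega>\<in>space M. u \<le> X a \<omega>} \<inter> W D)"
      using W[OF insert.hyps(1)] by (simp add: finite_measure_Diff)
    then have "prob (W (insert a D)) - (1 - p) ^ Suc (card D)
      = (1 - p) * (prob (W D) - (1 - p) ^ card D) - (prob ({\<omega>\<in>space M. u \<le> X a \<omega>} \<inter> W D) - p * prob (W D))"
      by (simp add: algebra_simps)
    moreover have "\<bar>(1 - p) * (prob (W D) - (1 - p) ^ card D)\<bar> \<le> real (card D) * err"
    proof -
      have "\<bar>(1 - p) * (prob (W D) - (1 - p) ^ card D)\<bar> \<le> 1 * \<bar>prob (W D) - (1 - p) ^ card D\<bar>"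
        unfolding abs_mult using p by (intro mult_right_mono) auto
      with insert.IH show ?thesis by simp
    qed
    ultimately show ?case using step[OF insert.hyps] insert.hyps by (simp add: distrib_right)
  qed
  then show ?thesis by (simp add: W_def)
qed

end

section \<open>Convergence of the maximum\<close>

text \<open>If \<open>green x\<close> equalled \<open>green 0\<close>, then \<open>X 0\<close> and
  \<open>X x\<close> would agree almost surely, and by translation invariance the field would be
  constant along the multiples of \<open>x\<close>, putting infinitely many points into one level
  set. The argument is carried out with nonnegative variances.\<close>

lemma green_less_green_0:
  fixes X :: "(int ^ 'd::finite) \<Rightarrow> 'a \<Rightarrow> real" and x :: "int ^ 'd"
  assumes d: "CARD('d) \<ge> 3" and field: "gaussian_field M X (\<lambda>a b. green (a - b))" and x: "x \<noteq> 0"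
  shows "green x < green (0 :: int ^ 'd)"
proof (rule ccontr)
  interpret gaussian_field M X "\<lambda>a b. green (a - b)" by fact
  define G where "G = green (0 :: int ^ 'd)"
  have G: "G \<ge> 1" using green_0_ge_1[OF d] by (simp add: G_def)
  have gm: "green (- y) = green y" for y :: "int ^ 'd" by (rule green_minus)
  have "0 \<le> var {0, x} (\<lambda>a. if a = 0 then 1 else - 1)"
    by (rule var_nonneg) simp
  then have "green x \<le> G"
    using x gm[of x] by (simp add: var_def G_def)
  moreover assume "\<not> green x < green (0 :: int ^ 'd)"
  ultimately have gx: "green x = G" by (simp add: G_def)
  have le: "green y \<le> G" for y :: "int ^ 'd"
  proof (cases "y = 0")
    case False
    have "0 \<le> var {0, y} (\<lambda>a. if a = 0 then 1 else - 1)"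
      by (rule var_nonneg) simp
    then show ?thesis using False gm[of y] by (simp add: var_def G_def)
  qed (simp add: G_def)
  define f where "f n = (\<chi> i. int n * x $ i)" for n
  obtain i where i: "x $ i \<noteq> 0" using x by (auto simp: vec_eq_iff)
  have f_Suc: "f (Suc n) = f n + x" for n by (simp add: f_def vec_eq_iff distrib_right)
  have f_ne: "f m \<noteq> f n" if "m \<noteq> n" for m n using i that by (auto simp: f_def vec_eq_iff)
  have f0: "f 0 = 0" by (simp add: f_def vec_eq_iff)
  have fG: "green (f n) = G" for n
  proof (induction n)
    case 0
    then show ?case by (simp add: f0 G_def)
  next
    case (Suc n)
    show ?case
    proof (cases "n = 0")
      case True
      then show ?thesis using f_Suc[of 0] f0 gx by simp
    next
      case False
      define y w where "y = f n" and "w = f (Suc n)"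
      have ne: "y \<noteq> 0" "w \<noteq> 0" "w \<noteq> y" using f_ne[of n 0] f_ne[of "Suc n" 0] f_ne[of "Suc n" n] False f0
        by (auto simp: y_def w_def)
      have gr: "green y = G" "green (w - y) = G" "green (y - w) = G"
        using Suc gx gm[of x] f_Suc[of n] by (auto simp: y_def w_def algebra_simps)
      \<comment> \<open>The second difference \<open>X 0 - 2 * X y + X w\<close> has variance
        \<open>2 * green w - 2 * G\<close> once \<open>green y\<close> and
        \<open>green (w - y)\<close> equal \<open>G\<close>.\<close>
      have "0 \<le> var {0, y, w} (\<lambda>a. if a = y then - 2 else 1)"
        by (rule var_nonneg) simp
      also have "\<dots> = 2 * green w - 2 * G"
        using ne ne[symmetric] gr gm[of y] gm[of w] by (simp add: var_def G_def[symmetric])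
      finally have "green w \<ge> G" by simp
      with le[of w] show ?thesis by (simp add: w_def)
    qed
  qed
  obtain K where K: "\<And>s. 0 < s \<Longrightarrow> s \<le> 1 \<Longrightarrow> finite {x :: int ^ 'd. s \<le> green x}"
    using green_level_set[OF d] by metis
  have "range f \<subseteq> {x. 1 \<le> green x}" using fG G by auto
  then have "finite (range f)" using K[of 1] finite_subset by auto
  moreover have "inj f" using f_ne by (auto simp: inj_def)
  ultimately show False using finite_imageD by blast
qed

text \<open>Values of at least 1/2 occur at finitely many points only, so strict inequality at each
  point becomes a uniform gap; \<open>G \<ge> 1\<close> takes care of all other points.\<close>

lemma green_spectral_gap:
  fixes X :: "(int ^ 'd::finite) \<Rightarrow> 'a \<Rightarrow> real"
  assumes d: "CARD('d) \<ge> 3" and field: "gaussian_field M X (\<lambda>a b. green (a - b))"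
  obtains r where "0 \<le> r" "r < green (0 :: int ^ 'd)" "\<And>x :: int ^ 'd. x \<noteq> 0 \<Longrightarrow> green x \<le> r"
proof -
  define G where "G = green (0 :: int ^ 'd)"
  have G: "G \<ge> 1" using green_0_ge_1[OF d] by (simp add: G_def)
  define S where "S = {x :: int ^ 'd. 1 / 2 \<le> green x}"
  obtain K where "\<And>s. 0 < s \<Longrightarrow> s \<le> 1 \<Longrightarrow> finite {x :: int ^ 'd. s \<le> green x}"
    using green_level_set[OF d] by metis
  from this[of "1 / 2"] have S: "finite S" unfolding S_def by simp
  define r where "r = Max (insert (1 / 2) (green ` (S - {0})))"
  show thesis
  proof (rule that)
    have "1 / 2 \<le> r" unfolding r_def using S by (intro Max_ge) auto
    then show "0 \<le> r" by simp
    show "r < green (0 :: int ^ 'd)"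
      unfolding r_def using S G green_less_green_0[OF d field] by (subst Max_less_iff) (auto simp: G_def)
    fix x :: "int ^ 'd" assume "x \<noteq> 0"
    show "green x \<le> r"
    proof (cases "x \<in> S")
      case True
      then show ?thesis unfolding r_def using S \<open>x \<noteq> 0\<close> by (intro Max_ge) auto
    next
      case False
      then show ?thesis using \<open>1 / 2 \<le> r\<close> by (simp add: S_def)
    qed
  qed
qed

lemma power_one_minus_limit:
  fixes p :: "nat \<Rightarrow> real"
  assumes p0: "\<And>N. 0 \<le> p N" and lim: "(\<lambda>N. real N * p N) \<longlonglongrightarrow> l"
  shows "(\<lambda>N. (1 - p N) ^ N) \<longlonglongrightarrow> exp (- l)"
proof (rule tendsto_sandwich)
  have inv: "(\<lambda>N. 1 / real N) \<longlonglongrightarrow> 0" by real_asymp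
  from tendsto_mult[OF lim inv] have "(\<lambda>N. real N * p N * (1 / real N)) \<longlonglongrightarrow> 0" by simp
  then have p_lim: "p \<longlonglongrightarrow> 0"
    by (rule Lim_transform_eventually) (use eventually_gt_at_top[of 0] in eventually_elim, simp)
  then have half: "\<forall>\<^sub>F N in sequentially. p N < 1 / 2" by (rule order_tendstoD) simp
  show "\<forall>\<^sub>F N in sequentially. (1 - p N) ^ N \<le> exp (- (real N * p N))"
    using half
  proof eventually_elim
    case (elim N)
    have "(1 - p N) ^ N \<le> exp (- p N) ^ N"
      using elim exp_ge_add_one_self[of "- p N"] by (intro power_mono) auto
    then show ?case by (simp add: exp_of_nat_mult[symmetric])
  qed
  show "\<forall>\<^sub>F N in sequentially. exp (- (real N * p N) - 2 * (real N * p N) * p N) \<le> (1 - p N) ^ N"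
    using half
  proof eventually_elim
    case (elim N)
    have "- p N - 2 * (p N)\<^sup>2 \<le> ln (1 - p N)"
      using ln_one_minus_pos_lower_bound[of "p N"] p0[of N] elim by simp
    then have "exp (- p N - 2 * (p N)\<^sup>2) \<le> 1 - p N"
      using elim by (subst (asm) ln_ge_iff) auto
    then have "exp (- p N - 2 * (p N)\<^sup>2) ^ N \<le> (1 - p N) ^ N" by (intro power_mono) auto
    then show ?case by (simp add: exp_of_nat_mult[symmetric] algebra_simps power2_eq_square)
  qed
  show "(\<lambda>N. exp (- (real N * p N))) \<longlonglongrightarrow> exp (- l)"
    by (intro tendsto_intros lim)
  have "(\<lambda>N. exp (- (real N * p N) - 2 * (real N * p N) * p N)) \<longlonglongrightarrow> exp (- l - 2 * l * 0)"
    by (intro tendsto_intros lim p_lim)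
  then show "(\<lambda>N. exp (- (real N * p N) - 2 * (real N * p N) * p N)) \<longlonglongrightarrow> exp (- l)" by simp
qed

theorem theorem1:
  fixes M :: "'a measure"
    and \<phi> :: "(int ^ 'd::finite) \<Rightarrow> 'a \<Rightarrow> real"
    and A :: "nat \<Rightarrow> (int ^ 'd) set"
    and z :: real
  assumes "CARD('d) \<ge> 3"
    and "centered_gaussian_field M \<phi> (\<lambda>\<alpha> \<beta>. green (\<alpha> - \<beta>))"
    and "\<And>N. finite (A N) \<and> card (A N) = N"
  shows "(\<lambda>N. measure M {\<omega> \<in> space M.
            (Max ((\<lambda>\<alpha>. \<phi> \<alpha> \<omega>) ` A N) - dgff_b (green (0::int^'d)) N)
              / dgff_a (green (0::int^'d)) N < z})
         \<longlonglongrightarrow> exp (- exp (- z))"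
proof -
  define G where "G = green (0 :: int ^ 'd)"
  have G: "G \<ge> 1" using green_0_ge_1[OF assms(1)] by (simp add: G_def)
  have sym: "green (a - b) = green (b - a)" for a b :: "int ^ 'd"
    using green_minus[of "a - b"] by simp
  have field: "gaussian_field M \<phi> (\<lambda>\<alpha> \<beta>. green (\<alpha> - \<beta>))"
    using assms(2) sym unfolding centered_gaussian_field_def gaussian_field_def gaussian_field_axioms_def by blast
  interpret gaussian_field M \<phi> "\<lambda>\<alpha> \<beta>. green (\<alpha> - \<beta>)" by (rule field)
  obtain r where r: "0 \<le> r" "r < G" "\<And>x :: int ^ 'd. x \<noteq> 0 \<Longrightarrow> green x \<le> r"
    unfolding G_def using green_spectral_gap[OF assms(1) field] by metis
  obtain K where K: "K > 0" "\<And>s. 0 < s \<Longrightarrow> s \<le> 1 \<Longrightarrow> finite {x :: int ^ 'd. s \<le> green x}"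
    "\<And>s. 0 < s \<Longrightarrow> s \<le> 1 \<Longrightarrow> real (card {x :: int ^ 'd. s \<le> green x}) \<le> K / s ^ 3"
    using green_level_set[OF assms(1)] by metis
  \<comment> \<open>The level \<open>2 * u\<close> for a pair sum, with
    \<open>u = sqrt G * x N\<close>, divided by the largest possible standard deviation
    \<open>sqrt (2 * G + 2 * r)\<close> of such a sum, is \<open>k * x N\<close>.\<close>
  define k where "k = 2 * sqrt G / sqrt (2 * G + 2 * r)"
  have k: "k > 1"
  proof -
    have "sqrt (2 * G + 2 * r) < sqrt (4 * G)" using r by simp
    also have "\<dots> = 2 * sqrt G" by (simp add: real_sqrt_mult)
    finally show ?thesis using G r by (simp add: k_def)
  qed
  define x where "x N = norm_b N + z / norm_b N" for N
  define p where "p N = gauss_tail (x N)" for N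
  define \<tau> where "\<tau> N = gauss_tail (k * x N)" for N
  \<comment> \<open>With \<open>s = G / (ln N)^2\<close> and
    \<open>\<eta> = e * sqrt G / norm_b N\<close>: \<open>n\<close> is \<open>K / s^3\<close>,
    \<open>y e\<close> is \<open>(u + \<eta>) / sqrt (G - s)\<close>, where the shift replaces
    \<open>z\<close> by \<open>z + e\<close>, and the last quotient in \<open>err\<close> is
    \<open>sqrt s / \<eta>\<close>.\<close>
  define n where "n N = K / G ^ 3 * ln (real N) ^ 6" for N
  define y where "y e N = (norm_b N + (z + e) / norm_b N) / sqrt (1 - 1 / (ln (real N))\<^sup>2)" for e N
  define err where "err e N = n N * \<tau> N + n N * (p N)\<^sup>2 + (\<bar>p N - gauss_tail (y e N)\<bar> + p N * (norm_b N / (e * ln (real N))))" for e N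
  define W where "W N = {\<omega>\<in>space M. \<forall>i\<in>A N. \<phi> i \<omega> < sqrt G * x N}" for N

  have lnN: "filterlim (\<lambda>N. ln (real N)) at_top sequentially" by real_asymp
  have x_top: "filterlim x at_top sequentially" unfolding x_def norm_b_def by real_asymp
  \<comment> \<open>\<open>G + 1 < ln N\<close> yields both \<open>s \<le> 1\<close>, the range of
    the level set bound, and \<open>s < G\<close>.\<close>
  have ev: "\<forall>\<^sub>F N in sequentially. 0 < norm_b N \<and> 0 < x N \<and> G + 1 < ln (real N) \<and> 0 < N"
    using norm_b_at_top x_top lnN by (auto simp: filterlim_at_top_dense eventually_conj_iff)

  have bound: "\<forall>\<^sub>F N in sequentially. \<bar>prob (W N) - (1 - p N) ^ N\<bar> \<le> real N * err e N" if e: "e > 0" for e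
    using ev
  proof eventually_elim
    case (elim N)
    define L where "L = ln (real N)"
    define s where "s = G / L\<^sup>2"
    have L: "G + 1 < L" "0 < L" using elim G unfolding L_def by linarith+
    have "G * 1 < L * L" using L G by (intro mult_strict_mono) auto
    then have s: "0 < s" "s \<le> 1" "s < G"
      using L G by (simp_all add: s_def power2_eq_square divide_less_eq)
    have level: "{b. s \<le> green (a - b)} = (\<lambda>x. a - x) ` {x. s \<le> green x}" for a :: "int ^ 'd"
    proof (intro set_eqI iffI)
      fix b assume "b \<in> {b. s \<le> green (a - b)}"
      then show "b \<in> (\<lambda>x. a - x) ` {x. s \<le> green x}" by (intro image_eqI[of _ _ "a - b"]) auto
    qed auto
    have n_eq: "n N = K / s ^ 3" by (simp add: n_def s_def L_def power_divide)
    have Gs: "sqrt (G - s) = sqrt G * sqrt (1 - 1 / L\<^sup>2)"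
      by (simp add: s_def real_sqrt_mult[symmetric] right_diff_distrib)
    have "\<bar>prob {\<omega>\<in>space M. \<forall>i\<in>A N. \<phi> i \<omega> < sqrt G * x N} - (1 - gauss_tail (sqrt G * x N / sqrt G)) ^ card (A N)\<bar>
      \<le> real (card (A N)) * (n N * \<tau> N + n N * (gauss_tail (sqrt G * x N / sqrt G))\<^sup>2
        + (\<bar>gauss_tail (sqrt G * x N / sqrt G) - gauss_tail ((sqrt G * x N + e * sqrt G / norm_b N) / sqrt (G - s))\<bar>
          + gauss_tail (sqrt G * x N / sqrt G) * (sqrt s / (e * sqrt G / norm_b N))))"
    proof (rule void_probability)
      show "finite (A N)" using assms(3) by blast
      show "\<exists>h. (\<forall>c. 0 \<le> h c) \<and> (\<Sum>c\<in>F. h c) \<le> 1 \<and> (\<forall>x\<in>F. green (a - x) = (\<Sum>c\<in>F. h c * green (c - x)))"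
        if "finite F" "a \<notin> F" for F and a :: "int ^ 'd"
        using green_balayage[OF assms(1) that] by metis
      show "finite {b. s \<le> green (a - b)}" for a :: "int ^ 'd"
        unfolding level using K(2)[OF s(1,2)] by simp
      show "real (card {b. s \<le> green (a - b)}) \<le> n N" for a :: "int ^ 'd"
        unfolding level n_eq using K(3)[OF s(1,2)] by (subst card_image) (auto simp: inj_on_def)
      show "prob {\<omega>\<in>space M. sqrt G * x N \<le> \<phi> a \<omega> \<and> sqrt G * x N \<le> \<phi> b \<omega>} \<le> \<tau> N" if "a \<noteq> b" for a b
      proof -
        have ab: "0 \<le> green (a - b)" "green (a - b) \<le> r" using green_nonneg[OF assms(1)] r(3)[of "a - b"] that by auto
        have "prob {\<omega>\<in>space M. sqrt G * x N \<le> \<phi> a \<omega> \<and> sqrt G * x N \<le> \<phi> b \<omega>}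
          \<le> gauss_tail (2 * (sqrt G * x N) / sqrt (green (a - a) + green (b - b) + 2 * green (a - b)))"
          by (rule pair_tail_le[OF that]) (use ab G in \<open>simp add: G_def\<close>)
        also have "\<dots> \<le> \<tau> N"
          unfolding \<tau>_def
        proof (rule gauss_tail_antimono)
          have "2 * (sqrt G * x N) / sqrt (2 * G + 2 * r) \<le> 2 * (sqrt G * x N) / sqrt (2 * G + 2 * green (a - b))"
            using ab G r elim by (intro divide_left_mono) auto
          then show "k * x N \<le> 2 * (sqrt G * x N) / sqrt (green (a - a) + green (b - b) + 2 * green (a - b))"
            by (simp add: k_def G_def mult.assoc)
        qed
        finally show ?thesis .
      qed
      show "green (a - a) = G" for a :: "int ^ 'd" by (simp add: G_def)
    qed (use s elim e G in \<open>auto simp: \<tau>_def gauss_tail_nonneg\<close>)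
    also have "sqrt G * x N / sqrt G = x N" using G by simp
    also have "(sqrt G * x N + e * sqrt G / norm_b N) / sqrt (G - s) = y e N"
    proof -
      have "sqrt G * x N + e * sqrt G / norm_b N = sqrt G * (norm_b N + (z + e) / norm_b N)"
        by (simp add: x_def distrib_left add_divide_distrib mult.commute)
      then show ?thesis unfolding Gs using G by (simp add: y_def L_def)
    qed
    also have "sqrt s / (e * sqrt G / norm_b N) = norm_b N / (e * L)"
      using L G by (simp add: s_def real_sqrt_divide)
    finally show ?case
      using assms(3)[of N] by (simp add: W_def p_def err_def L_def)
  qed

  have p_lim: "(\<lambda>N. real N * p N) \<longlonglongrightarrow> exp (- z)"
    unfolding p_def x_def by (rule gauss_tail_level)
  \<comment> \<open>For fixed \<open>e\<close> only the shift of the level survives in the limit;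
    \<open>diff\<close> then chooses \<open>e\<close> small.\<close>
  have err_lim: "(\<lambda>N. real N * err e N) \<longlonglongrightarrow> \<bar>exp (- z) - exp (- (z + e))\<bar>" if e: "e > 0" for e
  proof -
    have 1: "(\<lambda>N. K / G ^ 3 * (real N * ln (real N) ^ 6 * gauss_tail (k * (norm_b N + z / norm_b N)))) \<longlonglongrightarrow> K / G ^ 3 * 0"
      by (intro tendsto_intros gauss_tail_pair_level k)
    have "(\<lambda>N. ln (real N) ^ 6 / real N) \<longlonglongrightarrow> 0" by real_asymp
    then have 2: "(\<lambda>N. K / G ^ 3 * (ln (real N) ^ 6 / real N * (real N * p N)\<^sup>2)) \<longlonglongrightarrow> K / G ^ 3 * (0 * (exp (- z))\<^sup>2)"
      by (intro tendsto_intros p_lim)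
    have 3: "(\<lambda>N. \<bar>real N * p N - real N * gauss_tail (y e N)\<bar>) \<longlonglongrightarrow> \<bar>exp (- z) - exp (- (z + e))\<bar>"
      unfolding y_def by (intro tendsto_intros p_lim gauss_tail_perturbed_level)
    have "(\<lambda>N. norm_b N / ln (real N)) \<longlonglongrightarrow> 0" unfolding norm_b_def by real_asymp
    then have 4: "(\<lambda>N. real N * p N * (norm_b N / ln (real N) / e)) \<longlonglongrightarrow> exp (- z) * (0 / e)"
      using e by (intro tendsto_intros p_lim) auto
    have "(\<lambda>N. K / G ^ 3 * (real N * ln (real N) ^ 6 * gauss_tail (k * (norm_b N + z / norm_b N)))
        + K / G ^ 3 * (ln (real N) ^ 6 / real N * (real N * p N)\<^sup>2)
        + (\<bar>real N * p N - real N * gauss_tail (y e N)\<bar> + real N * p N * (norm_b N / ln (real N) / e)))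
      \<longlonglongrightarrow> \<bar>exp (- z) - exp (- (z + e))\<bar>"
      using tendsto_add[OF tendsto_add[OF 1 2] tendsto_add[OF 3 4]] by simp
    then show ?thesis
    proof (rule Lim_transform_eventually)
      show "\<forall>\<^sub>F N in sequentially. K / G ^ 3 * (real N * ln (real N) ^ 6 * gauss_tail (k * (norm_b N + z / norm_b N)))
        + K / G ^ 3 * (ln (real N) ^ 6 / real N * (real N * p N)\<^sup>2)
        + (\<bar>real N * p N - real N * gauss_tail (y e N)\<bar> + real N * p N * (norm_b N / ln (real N) / e)) = real N * err e N"
        using eventually_gt_at_top[of 0]
      proof eventually_elim
        case (elim N)
        have "\<bar>real N * p N - real N * gauss_tail (y e N)\<bar> = real N * \<bar>p N - gauss_tail (y e N)\<bar>"
          by (simp add: abs_mult flip: right_diff_distrib)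
        moreover have "ln (real N) ^ 6 / real N * (real N * p N)\<^sup>2 = real N * (ln (real N) ^ 6 * (p N)\<^sup>2)"
          using elim by (simp add: power2_eq_square)
        ultimately show ?case
          by (simp add: err_def n_def \<tau>_def x_def distrib_left mult_ac)
      qed
    qed
  qed

  have diff: "(\<lambda>N. prob (W N) - (1 - p N) ^ N) \<longlonglongrightarrow> 0"
  proof (rule LIMSEQ_I)
    fix q :: real assume q: "q > 0"
    have "((\<lambda>e. \<bar>exp (- z) - exp (- (z + e))\<bar>) \<longlongrightarrow> \<bar>exp (- z) - exp (- (z + 0))\<bar>) (at_right 0)"
      by (intro tendsto_intros)
    then have "\<forall>\<^sub>F e in at_right 0. \<bar>exp (- z) - exp (- (z + e))\<bar> < q"
      using q by (intro order_tendstoD(2)[where a = q]) auto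
    moreover have "\<forall>\<^sub>F e in at_right (0::real). 0 < e" by (simp add: eventually_at_right_less)
    ultimately have "\<forall>\<^sub>F e in at_right 0. \<bar>exp (- z) - exp (- (z + e))\<bar> < q \<and> 0 < e"
      by (rule eventually_conj)
    then obtain e where e: "\<bar>exp (- z) - exp (- (z + e))\<bar> < q" "e > 0"
      using eventually_happens'[OF trivial_limit_at_right_real] by blast
    have "\<forall>\<^sub>F N in sequentially. real N * err e N < q"
      using order_tendstoD(2)[OF err_lim[OF e(2)] e(1)] .
    with bound[OF e(2)] have "\<forall>\<^sub>F N in sequentially. norm (prob (W N) - (1 - p N) ^ N - 0) < q"
      by eventually_elim simp
    then show "\<exists>N0. \<forall>N\<ge>N0. norm (prob (W N) - (1 - p N) ^ N - 0) < q"
      by (simp add: eventually_sequentially)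
  qed
  have "(\<lambda>N. (1 - p N) ^ N) \<longlonglongrightarrow> exp (- exp (- z))"
    by (rule power_one_minus_limit[OF _ p_lim]) (simp add: p_def gauss_tail_nonneg)
  from tendsto_add[OF diff this] have lim: "(\<lambda>N. prob (W N)) \<longlonglongrightarrow> exp (- exp (- z))" by simp
  \<comment> \<open>Small \<open>N\<close> are excluded: \<open>A N\<close> must be nonempty for
    \<open>Max\<close> to be meaningful, and \<open>dgff_a\<close> positive for the inequality to be
    rearranged.\<close>
  have "\<forall>\<^sub>F N in sequentially. prob (W N) = measure M {\<omega> \<in> space M.
            (Max ((\<lambda>\<alpha>. \<phi> \<alpha> \<omega>) ` A N) - dgff_b G N) / dgff_a G N < z}"
    using ev
  proof eventually_elim
    case (elim N)
    have A: "finite (A N)" "A N \<noteq> {}" using assms(3)[of N] elim by auto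
    have a: "dgff_a G N = sqrt G / norm_b N"
      using G real_div_sqrt[of G] unfolding dgff_a_def dgff_b_eq divide_divide_eq_left[symmetric] by simp
    have a0: "dgff_a G N > 0" unfolding a using G elim by simp
    have "(m - dgff_b G N) / dgff_a G N < z \<longleftrightarrow> m < sqrt G * x N" for m
    proof -
      have "sqrt G * x N = z * dgff_a G N + dgff_b G N"
        by (simp add: a dgff_b_eq x_def distrib_left mult.commute)
      then show ?thesis using a0 by (simp add: pos_divide_less_eq diff_less_eq)
    qed
    then show ?case unfolding W_def using A by (auto intro!: arg_cong[of _ _ prob] simp: Max_less_iff)
  qed
  from Lim_transform_eventually[OF lim this] show ?thesis by (simp add: G_def)
qed

end
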